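(* Let $s_0=\lceil\log_2\log_2 4n\rceil$ and $c=\frac{3+\sqrt{33}}4$, and run the algorithm VRAG (described in the context; it uses the smoothness parameter $\beta$) with $$a^{(s)}=\begin{cases}1-(4n)^{-0.5^{s}}&1\le s\le s_0\\ \frac{c}{s-s_0+2c}&s>s_0\end{cases},\qquad T_s=n,$$ where $(4n)^{-0.5^s}$ means $(4n)^{-(0.5^s)}$. Set $V=\frac12(F(u^{(0)})-F(x^* ))+\beta\|u^{(0)}-x^*\|^2$. Then for every $\epsilon>0$ there is a number of epochs $S\ge1$ such that the output satisfies $\mathbb E[F(u^{(S)})-F(x^* )]\le\epsilon$ and the number of individual gradient evaluations used is $$\#grads=\begin{cases}\mathcal O\left(n\log\log\frac V\epsilon\right)&\epsilon\ge\frac Vn\\[2pt]\mathcal O\left(n\log\log n+\sqrt{\frac{nV}\epsilon}\right)&\epsilon<\frac Vn\end{cases}.$$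
   Context: Problem. $n,d\ge1$ are integers, $\mathcal X\subseteq\mathbb R^d$ is a nonempty closed convex set (not assumed bounded), $f_1,\dots,f_n:\mathbb R^d\to\mathbb R$ are convex, differentiable and $\beta$-smooth with $\beta>0$, i.e. $\|\nabla f_i(x)-\nabla f_i(y)\|\le\beta\|x-y\|$ for all $x,y\in\mathbb R^d$; $f=\frac1n\sum_{i=1}^n f_i$; $h:\mathcal X\to\mathbb R$ is convex, possibly nonsmooth, and such that $\arg\min_{x\in\mathcal X}(\lambda h(x)+\frac12\|x-v\|^2)$ exists for all $\lambda\ge0$, $v\in\mathbb R^d$. $F=f+h$ and $x^*\in\arg\min_{x\in\mathcal X}F(x)$ (assumed to exist). $\|\cdot\|$ is the Euclidean norm. Algorithm VRAG. Input $u^{(0)}\in\mathcal X$ and $\beta$. Parameters: $a^{(s)}\in(0,1)$, positive integers $T_s$ ($s\ge1$). Initialize $x_0^{(1)}=u^{(0)}$. For $s=1,\dots,S$: set $\overline x_0^{(s)}=a^{(s)}x_0^{(s)}+(1-a^{(s)})u^{(s-1)}$ and compute $\nabla f(u^{(s-1)})$; for $t=1,\dots,T_s$: - draw $i_t^{(s)}$ uniformly from $\{1,\dots,n\}$, independently of everything before, and set $g_t^{(s)}=\nabla f_{i_t^{(s)}}(\overline x_{t-1}^{(s)})-\nabla f_{i_t^{(s)}}(u^{(s-1)})+\nabla f(u^{(s-1)})$; - $x_t^{(s)}=\arg\min_{x\in\mathcal X}\{\langle g_t^{(s)},x\rangle+h(x)+\frac{\beta(2-a^{(s)})a^{(s)}}{2(1-a^{(s)})}\|x-x_{t-1}^{(s)}\|^2\}$;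 - $\overline x_t^{(s)}=a^{(s)}x_t^{(s)}+(1-a^{(s)})u^{(s-1)}$. At the end of epoch $s$: $u^{(s)}=\frac1{T_s}\sum_{t=1}^{T_s}\overline x_t^{(s)}$, $x_0^{(s+1)}=x_{T_s}^{(s)}$. Output $u^{(S)}$. Counting. An evaluation of some $\nabla f_i$ at a point counts as one individual gradient evaluation; computing $\nabla f$ at a point counts as $n$. $\mathcal O(\cdot)$ hides absolute constants; iterated logarithms $\log\log(\cdot)$ inside $\mathcal O$ are read as $\max\{1,\log\log(\cdot)\}$ (and as $1$ when undefined). *)

theory Defs
  imports "HOL-Probability.Probability"
begin

text \<open>
  The constant hidden in the complexity bound is absolute, in particular independent of the
  dimension, so the dimension has to be quantified inside the statement and cannot be a type.
  All spaces \<open>\<real>\<^sup>d\<close> are therefore realised as subspaces of one inner product space, the space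
  of finitely supported real sequences with the Euclidean inner product.
  (The library's \<open>poly_mapping\<close> carries the sum norm and is not an inner product space.)
\<close>

typedef fsvec = "{x :: nat \<Rightarrow> real. finite {i. x i \<noteq> 0}}"
  morphisms coord Abs_fsvec
  by (rule exI[of _ "\<lambda>_. 0"]) simp

setup_lifting type_definition_fsvec

lemma finite_coord [simp]: "finite {i. coord x i \<noteq> 0}"
  using coord[of x] by simp

lemma fsvec_eqI: "(\<And>i. coord x i = coord y i) \<Longrightarrow> x = y"
  by (simp add: coord_inject[symmetric] ext)

instantiation fsvec :: real_vector
begin

lift_definition zero_fsvec :: fsvec is "\<lambda>_. 0" by simp

lift_definition plus_fsvec :: "fsvec \<Rightarrow> fsvec \<Rightarrow> fsvec" is "\<lambda>x y i. x i + y i"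
  proof -
  fix x y :: "nat \<Rightarrow> real"
  assume "finite {i. x i \<noteq> 0}" "finite {i. y i \<noteq> 0}"
  then show "finite {i. x i + y i \<noteq> 0}"
    by (intro finite_subset[of "{i. x i + y i \<noteq> 0}" "{i. x i \<noteq> 0} \<union> {i. y i \<noteq> 0}"]) auto
qed

lift_definition minus_fsvec :: "fsvec \<Rightarrow> fsvec \<Rightarrow> fsvec" is "\<lambda>x y i. x i - y i"
  proof -
  fix x y :: "nat \<Rightarrow> real"
  assume "finite {i. x i \<noteq> 0}" "finite {i. y i \<noteq> 0}"
  then show "finite {i. x i - y i \<noteq> 0}"
    by (intro finite_subset[of "{i. x i - y i \<noteq> 0}" "{i. x i \<noteq> 0} \<union> {i. y i \<noteq> 0}"]) auto
qed

lift_definition uminus_fsvec :: "fsvec \<Rightarrow> fsvec" is "\<lambda>x i. - x i"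
  by simp

lift_definition scaleR_fsvec :: "real \<Rightarrow> fsvec \<Rightarrow> fsvec" is "\<lambda>c x i. c * x i"
  by (erule rev_finite_subset) auto

instance
  by standard (transfer; simp add: algebra_simps fun_eq_iff)+

end

lemma coord_simps [simp]:
  "coord 0 i = 0"
  "coord (x + y) i = coord x i + coord y i"
  "coord (x - y) i = coord x i - coord y i"
  "coord (- x) i = - coord x i"
  "coord (c *\<^sub>R x) i = c * coord x i"
  by (transfer; simp)+

instantiation fsvec :: real_inner
begin

definition inner_fsvec :: "fsvec \<Rightarrow> fsvec \<Rightarrow> real"
  where "inner x y = (\<Sum>i | coord x i \<noteq> 0. coord x i * coord y i)"

definition norm_fsvec :: "fsvec \<Rightarrow> real"
  where "norm_fsvec x = sqrt (inner x x)"

definition sgn_fsvec :: "fsvec \<Rightarrow> fsvec"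
  where "sgn_fsvec x = x /\<^sub>R norm x"

definition dist_fsvec :: "fsvec \<Rightarrow> fsvec \<Rightarrow> real"
  where "dist_fsvec x y = norm (x - y)"

definition uniformity_fsvec :: "(fsvec \<times> fsvec) filter"
  where "uniformity_fsvec = (INF e\<in>{0<..}. principal {(x, y). dist x y < e})"

definition open_fsvec :: "fsvec set \<Rightarrow> bool"
  where "open_fsvec U \<longleftrightarrow> (\<forall>x\<in>U. \<forall>\<^sub>F (x', y) in uniformity. x' = x \<longrightarrow> y \<in> U)"

lemma inner_fsvec_superset:
  assumes "finite I" "{i. coord x i \<noteq> 0} \<subseteq> I"
  shows "inner x y = (\<Sum>i\<in>I. coord x i * coord y i)"
  unfolding inner_fsvec_def by (rule sum.mono_neutral_left) (use assms in auto)

instance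
proof
  fix x y z :: fsvec and r :: real
  let ?I = "{i. coord x i \<noteq> 0} \<union> {i. coord y i \<noteq> 0}"
  show "inner x y = inner y x"
    by (subst (1 2) inner_fsvec_superset[of ?I]) (auto simp: mult.commute)
  show "inner (x + y) z = inner x z + inner y z"
    by (subst (1 2 3) inner_fsvec_superset[of ?I])
       (auto simp: sum.distrib[symmetric] algebra_simps)
  show "inner (r *\<^sub>R x) y = r * inner x y"
    by (subst (1 2) inner_fsvec_superset[of ?I]) (auto simp: sum_distrib_left mult.assoc)
  show "0 \<le> inner x x"
    by (simp add: inner_fsvec_def sum_nonneg)
  show "(inner x x = 0) = (x = 0)"
    by (auto simp: inner_fsvec_def sum_nonneg_eq_0_iff intro!: fsvec_eqI)
qed (fact norm_fsvec_def sgn_fsvec_def dist_fsvec_def uniformity_fsvec_def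
      open_fsvec_def)+

end

definition Rd :: "nat \<Rightarrow> fsvec set"
  where "Rd d = {x. \<forall>i\<ge>d. coord x i = 0}"

lemma subspace_Rd: "subspace (Rd d)"
  by (simp add: subspace_def Rd_def)

lemma inner_Rd: "x \<in> Rd d \<Longrightarrow> inner x y = (\<Sum>i<d. coord x i * coord y i)"
  by (rule inner_fsvec_superset) (auto simp: Rd_def not_le[symmetric])

lemma norm_Rd: "x \<in> Rd d \<Longrightarrow> norm x = L2_set (coord x) {..<d}"
  by (simp add: norm_fsvec_def inner_Rd L2_set_def power2_eq_square)

lemma Rd_coord_bij: "bij_betw coord (Rd d) {c. \<forall>i\<ge>d. c i = 0}"
proof (rule bij_betw_imageI)
  show "inj_on coord (Rd d)"
    by (simp add: inj_on_def coord_inject)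
  have "c \<in> coord ` Rd d" if "\<forall>i\<ge>d. c i = 0" for c
  proof
    have "finite {i. c i \<noteq> 0}"
      by (rule finite_subset[of _ "{..<d}"]) (use that in \<open>auto simp: not_le[symmetric]\<close>)
    then show "c = coord (Abs_fsvec c)" by (simp add: Abs_fsvec_inverse)
    then show "Abs_fsvec c \<in> Rd d" using that by (simp add: Rd_def)
  qed
  then show "coord ` Rd d = {c. \<forall>i\<ge>d. c i = 0}"
    by (auto simp: Rd_def)
qed

text \<open>
  Functions on \<open>\<real>\<^sup>d\<close> are functions on \<open>fsvec\<close> of which only the values on \<open>Rd d\<close> matter; hence
  the derivative within \<open>Rd d\<close>, which determines a gradient in \<open>Rd d\<close> uniquely.
\<close>

definition grad :: "nat \<Rightarrow> (fsvec \<Rightarrow> real) \<Rightarrow> fsvec \<Rightarrow> fsvec"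
  where "grad d \<phi> x =
    (THE g. g \<in> Rd d \<and> (\<phi> has_derivative (\<lambda>v. inner g v)) (at x within Rd d))"

definition favg :: "nat \<Rightarrow> (nat \<Rightarrow> fsvec \<Rightarrow> real) \<Rightarrow> fsvec \<Rightarrow> real"
  where "favg n f x = (1 / real n) * (\<Sum>i=1..n. f i x)"

definition objective ::
    "nat \<Rightarrow> (nat \<Rightarrow> fsvec \<Rightarrow> real) \<Rightarrow> (fsvec \<Rightarrow> real) \<Rightarrow> fsvec \<Rightarrow> real"
  where "objective n f h x = favg n f x + h x"

text \<open>Only the values of \<open>h\<close> on \<open>X\<close> matter.\<close>

definition composite_problem ::
    "nat \<Rightarrow> nat \<Rightarrow> real \<Rightarrow> fsvec set \<Rightarrow> (nat \<Rightarrow> fsvec \<Rightarrow> real) \<Rightarrow> (fsvec \<Rightarrow> real) \<Rightarrow> bool"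
  where "composite_problem d n \<beta> X f h \<longleftrightarrow>
    1 \<le> d \<and> 1 \<le> n \<and> 0 < \<beta> \<and>
    X \<subseteq> Rd d \<and> X \<noteq> {} \<and> closed X \<and> convex X \<and>
    (\<forall>i\<in>{1..n}. convex_on (Rd d) (f i) \<and> f i differentiable_on Rd d \<and>
       (\<forall>x\<in>Rd d. \<forall>y\<in>Rd d. norm (grad d (f i) x - grad d (f i) y) \<le> \<beta> * norm (x - y))) \<and>
    convex_on X h \<and>
    (\<forall>\<eta>\<ge>0. \<forall>v\<in>Rd d. \<exists>x. is_arg_min (\<lambda>x. \<eta> * h x + 1/2 * (norm (x - v))\<^sup>2) (\<lambda>x. x \<in> X) x)"

text \<open>
  One epoch with anchor \<open>u\<close>, weight \<open>a\<close>, starting point \<open>x0\<close> and drawn indices \<open>j 1, j 2, \<dots>\<close>: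
  the result for \<open>t\<close> is the iterate \<open>x\<^sub>t\<close>.
  The minimiser selected by \<open>arg_min_on\<close> is unique, the minimised function being strongly convex.
\<close>

definition grad_estimate ::
    "nat \<Rightarrow> nat \<Rightarrow> (nat \<Rightarrow> fsvec \<Rightarrow> real) \<Rightarrow> fsvec \<Rightarrow> fsvec \<Rightarrow> nat \<Rightarrow> fsvec"
  where "grad_estimate d n f u xbar i =
    grad d (f i) xbar - grad d (f i) u + grad d (favg n f) u"

primrec vrag_inner ::
    "nat \<Rightarrow> nat \<Rightarrow> real \<Rightarrow> fsvec set \<Rightarrow> (nat \<Rightarrow> fsvec \<Rightarrow> real) \<Rightarrow> (fsvec \<Rightarrow> real) \<Rightarrow>
     real \<Rightarrow> fsvec \<Rightarrow> fsvec \<Rightarrow> (nat \<Rightarrow> nat) \<Rightarrow> nat \<Rightarrow> fsvec"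
  where
    "vrag_inner d n \<beta> X f h a u x0 j 0 = x0"
  | "vrag_inner d n \<beta> X f h a u x0 j (Suc t) =
      (let x = vrag_inner d n \<beta> X f h a u x0 j t;
           xbar = a *\<^sub>R x + (1 - a) *\<^sub>R u;
           g = grad_estimate d n f u xbar (j (Suc t))
       in arg_min_on
            (\<lambda>z. inner g z + h z + \<beta> * (2 - a) * a / (2 * (1 - a)) * (norm (z - x))\<^sup>2) X)"

text \<open>
  After \<open>s\<close> epochs the state is the pair of the anchor \<open>u\<^sup>(\<^sup>s\<^sup>)\<close> and the next starting point, which
  is the last inner iterate; \<open>\<omega> (s, t)\<close> is the index drawn in step \<open>t\<close> of epoch \<open>s\<close>.
\<close>

primrec vrag_state ::
    "nat \<Rightarrow> nat \<Rightarrow> real \<Rightarrow> fsvec set \<Rightarrow> (nat \<Rightarrow> fsvec \<Rightarrow> real) \<Rightarrow> (fsvec \<Rightarrow> real) \<Rightarrow>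
     (nat \<Rightarrow> real) \<Rightarrow> (nat \<Rightarrow> nat) \<Rightarrow> fsvec \<Rightarrow> (nat \<times> nat \<Rightarrow> nat) \<Rightarrow> nat \<Rightarrow> fsvec \<times> fsvec"
  where
    "vrag_state d n \<beta> X f h a T u0 \<omega> 0 = (u0, u0)"
  | "vrag_state d n \<beta> X f h a T u0 \<omega> (Suc s) =
      (let (u, x0) = vrag_state d n \<beta> X f h a T u0 \<omega> s;
           a' = a (Suc s);
           T' = T (Suc s);
           x = vrag_inner d n \<beta> X f h a' u x0 (\<lambda>t. \<omega> (Suc s, t))
       in ((1 / real T') *\<^sub>R (\<Sum>t=1..T'. a' *\<^sub>R x t + (1 - a') *\<^sub>R u), x T'))"

definition vrag_output ::
    "nat \<Rightarrow> nat \<Rightarrow> real \<Rightarrow> fsvec set \<Rightarrow> (nat \<Rightarrow> fsvec \<Rightarrow> real) \<Rightarrow> (fsvec \<Rightarrow> real) \<Rightarrow>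
     (nat \<Rightarrow> real) \<Rightarrow> (nat \<Rightarrow> nat) \<Rightarrow> fsvec \<Rightarrow> nat \<Rightarrow> (nat \<times> nat \<Rightarrow> nat) \<Rightarrow> fsvec"
  where "vrag_output d n \<beta> X f h a T u0 S \<omega> = fst (vrag_state d n \<beta> X f h a T u0 \<omega> S)"

text \<open>The indices drawn during \<open>S\<close> epochs are independent and uniform on \<open>{1..n}\<close>.\<close>

definition vrag_draws :: "nat \<Rightarrow> (nat \<Rightarrow> nat) \<Rightarrow> nat \<Rightarrow> (nat \<times> nat \<Rightarrow> nat) pmf"
  where "vrag_draws n T S =
    Pi_pmf (SIGMA s:{1..S}. {1..T s}) 0 (\<lambda>_. pmf_of_set {1..n})"

text \<open>
  Each epoch computes one full gradient, at cost \<open>n\<close>, and each inner step evaluates the gradient of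
  the drawn component both at the current averaged point and at the anchor.
\<close>

definition vrag_grads :: "nat \<Rightarrow> (nat \<Rightarrow> nat) \<Rightarrow> nat \<Rightarrow> nat"
  where "vrag_grads n T S = (\<Sum>s=1..S. n + 2 * T s)"

definition s0 :: "nat \<Rightarrow> nat"
  where "s0 n = nat \<lceil>log 2 (log 2 (4 * real n))\<rceil>"

definition vrag_c :: real
  where "vrag_c = (3 + sqrt 33) / 4"

definition vrag_a :: "nat \<Rightarrow> nat \<Rightarrow> real"
  where "vrag_a n s =
    (if s \<le> s0 n then 1 - (4 * real n) powr (- ((1/2) ^ s))
     else vrag_c / (real s - real (s0 n) + 2 * vrag_c))"

text \<open>
  The iterated logarithm inside \<open>\<O>\<close>: at least 1, and 1 where it is undefined.
  The base of the logarithm only affects the absolute constant.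
\<close>

definition loglog :: "real \<Rightarrow> real"
  where "loglog x = (if x > 1 then max 1 (ln (ln x)) else 1)"

end

theory Submission
  imports Defs
begin

text \<open>
  Write \<open>\<Delta>\<close> for the expected optimality gap of an anchor, \<open>D\<close> for the expected squared distance to
  \<open>x\<^sup>*\<close> of the starting point of an epoch and \<open>w = \<beta> (2 - a) a\<^sup>2 / (2 (1 - a))\<close>. The prox coefficient
  is such that the quadratic terms of the descent lemma and of Young's inequality for the gradient
  noise are absorbed exactly, and the variance of the gradient estimate is at most
  \<open>2 \<beta> (f u - f \<xi> - \<langle>\<nabla> f \<xi>, u - \<xi>\<rangle>)\<close> at the averaged point \<open>\<xi>\<close>. Averaging over an epoch gives
  \<open>\<Delta>' + (w / n) D' \<le> (1 - a) \<Delta> + (w / n) D\<close>.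

  For \<open>s \<le> s\<^sub>0\<close> put \<open>q\<^sub>s = 1 - a\<^sub>s\<close>, so that \<open>q\<^sub>s\<^sup>2 = q\<^sub>s\<^sub>-\<^sub>1\<close>. Then \<open>w\<^sub>s \<le> q\<^sub>s w\<^sub>s\<^sub>-\<^sub>1\<close>, hence
  \<open>\<Delta>\<^sub>s + (w\<^sub>s / n) D\<^sub>s\<close> contracts by the factor \<open>q\<^sub>s\<close> from at most
  \<open>2 q\<^sub>1 V\<close> at \<open>s = 1\<close> and is at most \<open>V / (2 n q\<^sub>s)\<close>, which is at
  most \<open>V / n\<close> at \<open>s = s\<^sub>0\<close>. Afterwards, the inequality divided by \<open>w\<^sub>s\<close> telescopes, which gives
  the bound \<open>100 V / (n k\<^sup>2)\<close> after \<open>k\<close> further epochs.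
\<close>

section \<open>Convex functions and their gradients\<close>

text \<open>A line through \<open>x\<close> in a direction of \<open>W\<close> stays in
  \<open>W\<close>, so the chain rule applies with the derivative within \<open>W\<close>.
  Uniqueness of gradients, the descent lemma and the tangent inequality thereby become one-variable
  facts.\<close>

lemma line_derivative:
  fixes \<phi> :: "'a::real_inner \<Rightarrow> real"
  assumes W: "subspace W" "x \<in> W" "v \<in> W"
    and d: "(\<phi> has_derivative (\<lambda>v. inner g v)) (at (x + t *\<^sub>R v) within W)"
  shows "((\<lambda>t. \<phi> (x + t *\<^sub>R v)) has_real_derivative inner g v) (at t)"
proof -
  have sub: "range (\<lambda>t. x + t *\<^sub>R v) \<subseteq> W"
    using W by (auto intro: subspace_add subspace_mul)
  have "((\<lambda>t. x + t *\<^sub>R v) has_derivative (\<lambda>t. t *\<^sub>R v)) (at t)"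
    by (auto intro!: derivative_eq_intros)
  from has_derivative_in_compose[OF this has_derivative_subset[OF d sub]]
  show ?thesis
    by (simp add: has_field_derivative_def mult_commute_abs)
qed

text \<open>The difference of the two candidates is itself a direction in \<open>W\<close>; testing
  both derivatives on it gives squared norm 0.\<close>

lemma gradient_within_subspace_unique:
  fixes \<phi> :: "'a::real_inner \<Rightarrow> real"
  assumes W: "subspace W" "x \<in> W" "g \<in> W" "g' \<in> W"
    and d: "(\<phi> has_derivative (\<lambda>v. inner g v)) (at x within W)"
      "(\<phi> has_derivative (\<lambda>v. inner g' v)) (at x within W)"
  shows "g = g'"
proof -
  define v where "v = g - g'"
  have v: "v \<in> W" using W by (simp add: v_def subspace_diff)
  have "inner g v = inner g' v"
    using line_derivative[OF W(1,2) v, of \<phi> _ 0] d by (metis DERIV_unique add.right_neutral scale_zero_left)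
  then have "inner v v = 0" by (simp add: v_def inner_diff_left)
  then show ?thesis by (simp add: v_def)
qed

text \<open>Phrased for an arbitrary field \<open>G\<close> in any real inner product space, so that
  the inequalities below can be proved without unfolding the definite description in
  \<open>grad\<close>.\<close>

definition is_gradient :: "'a::real_inner set \<Rightarrow> ('a \<Rightarrow> real) \<Rightarrow> ('a \<Rightarrow> 'a) \<Rightarrow> bool"
  where "is_gradient W \<phi> G \<longleftrightarrow>
    (\<forall>x\<in>W. G x \<in> W \<and> (\<phi> has_derivative (\<lambda>v. inner (G x) v)) (at x within W))"

section \<open>Existence of gradients on the coordinate subspaces\<close>

definition basis_vec :: "nat \<Rightarrow> fsvec"
  where "basis_vec i = Abs_fsvec (\<lambda>k. if k = i then 1 else 0)"

lemma coord_basis_vec [simp]: "coord (basis_vec i) k = (if k = i then 1 else 0)"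
  unfolding basis_vec_def by (subst Abs_fsvec_inverse) auto

lemma coord_sum [simp]: "coord (sum g A) k = (\<Sum>i\<in>A. coord (g i) k)"
  by (induction A rule: infinite_finite_induct) auto

lemma Rd_expansion:
  assumes "x \<in> Rd d"
  shows "x = (\<Sum>i<d. coord x i *\<^sub>R basis_vec i)"
proof (rule fsvec_eqI)
  fix k
  have "(\<Sum>i<d. coord x i * (if k = i then 1 else 0)) = (if k < d then coord x k else 0)"
    by (simp add: mult_delta_right)
  then show "coord x k = coord (\<Sum>i<d. coord x i *\<^sub>R basis_vec i) k"
    using assms by (auto simp: Rd_def)
qed

lemma grad_eqI:
  assumes "x \<in> Rd d" "g \<in> Rd d" "(\<phi> has_derivative (\<lambda>v. inner g v)) (at x within Rd d)"
  shows "grad d \<phi> x = g"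
  unfolding grad_def
proof (rule the_equality)
  fix g' assume "g' \<in> Rd d \<and> (\<phi> has_derivative (\<lambda>v. inner g' v)) (at x within Rd d)"
  then show "g' = g"
    using gradient_within_subspace_unique[OF subspace_Rd assms(1) _ assms(2) _ assms(3)] by simp
qed (use assms in simp)

text \<open>Riesz representation in coordinates: the values of the derivative on the first
  \<open>d\<close> basis vectors are the coordinates of the representing vector, which therefore
  lies in \<open>Rd d\<close>.\<close>

lemma is_gradient_grad:
  assumes "\<phi> differentiable_on Rd d"
  shows "is_gradient (Rd d) \<phi> (grad d \<phi>)"
  unfolding is_gradient_def
proof
  fix x assume x: "x \<in> Rd d"
  obtain D where D: "(\<phi> has_derivative D) (at x within Rd d)"
    using assms x by (auto simp: differentiable_on_def differentiable_def)
  then interpret D: bounded_linear D by (rule has_derivative_bounded_linear)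
  define g where "g = (\<Sum>i<d. D (basis_vec i) *\<^sub>R basis_vec i)"
  have g: "g \<in> Rd d" by (auto simp: g_def Rd_def intro!: sum.neutral)
  have gD: "inner g v = D v" if "v \<in> Rd d" for v
  proof -
    have "inner g v = (\<Sum>i<d. coord g i * coord v i)" using g by (rule inner_Rd)
    also have "\<dots> = (\<Sum>i<d. coord v i * D (basis_vec i))"
      by (intro sum.cong) (simp_all add: g_def mult_delta_right)
    also have "\<dots> = D (\<Sum>i<d. coord v i *\<^sub>R basis_vec i)"
      by (simp add: D.sum D.scaleR)
    also have "\<dots> = D v" using Rd_expansion[OF that] by simp
    finally show ?thesis .
  qed
  \<comment> \<open>\<open>D\<close> and \<open>inner g\<close> agree on \<open>Rd d\<close>; this
    suffices, because the limit within \<open>Rd d\<close> only sees increments \<open>y - x\<close>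
    in \<open>Rd d\<close>.\<close>
  have "(\<phi> has_derivative (\<lambda>v. inner g v)) (at x within Rd d)"
    unfolding has_derivative_within
  proof
    show "bounded_linear (inner g)" by (rule bounded_linear_inner_right)
    have "((\<lambda>y. (1 / norm (y - x)) *\<^sub>R (\<phi> y - (\<phi> x + D (y - x)))) \<longlongrightarrow> 0) (at x within Rd d)"
      using D by (simp add: has_derivative_within)
    then show "((\<lambda>y. (1 / norm (y - x)) *\<^sub>R (\<phi> y - (\<phi> x + inner g (y - x)))) \<longlongrightarrow> 0) (at x within Rd d)"
      by (rule Lim_transform_within[OF _ zero_less_one])
        (simp only: gD subspace_diff[OF subspace_Rd _ x])
  qed
  then show "grad d \<phi> x \<in> Rd d \<and>
      (\<phi> has_derivative (\<lambda>v. inner (grad d \<phi> x) v)) (at x within Rd d)"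
    using g grad_eqI[OF x g] by simp
qed

lemma is_gradient_favg:
  assumes "\<And>i. i \<in> {1..n} \<Longrightarrow> is_gradient (Rd d) (f i) (G i)"
  shows "is_gradient (Rd d) (favg n f) (\<lambda>x. (1 / real n) *\<^sub>R (\<Sum>i=1..n. G i x))"
  unfolding is_gradient_def
proof (intro ballI conjI)
  fix x assume x: "x \<in> Rd d"
  show "(1 / real n) *\<^sub>R (\<Sum>i=1..n. G i x) \<in> Rd d"
    using assms x by (auto simp: is_gradient_def intro!: subspace_mul subspace_sum subspace_Rd)
  have "((\<lambda>x. (1 / real n) * (\<Sum>i=1..n. f i x)) has_derivative
      (\<lambda>v. (1 / real n) * (\<Sum>i=1..n. inner (G i x) v))) (at x within Rd d)"
    using assms x by (intro has_derivative_mult_right has_derivative_sum) (auto simp: is_gradient_def)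
  then show "(favg n f has_derivative
      (\<lambda>v. inner ((1 / real n) *\<^sub>R (\<Sum>i=1..n. G i x)) v)) (at x within Rd d)"
    by (simp add: favg_def[abs_def] inner_sum_left)
qed

lemma convex_on_sum_fun:
  fixes f :: "'i \<Rightarrow> 'a::real_vector \<Rightarrow> real"
  assumes "convex S" "\<And>i. i \<in> I \<Longrightarrow> convex_on S (f i)"
  shows "convex_on S (\<lambda>x. \<Sum>i\<in>I. f i x)"
  using assms(2)
  by (induction I rule: infinite_finite_induct) (auto simp: convex_on_const assms(1))

section \<open>Inequalities for smooth convex functions\<close>

lemma descent_lemma:
  fixes \<phi> :: "'a::real_inner \<Rightarrow> real"
  assumes W: "subspace W" "x \<in> W" "y \<in> W" and G: "is_gradient W \<phi> G"
    and lip: "\<And>x y. x \<in> W \<Longrightarrow> y \<in> W \<Longrightarrow> norm (G x - G y) \<le> \<beta> * norm (x - y)"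
  shows "\<phi> y \<le> \<phi> x + inner (G x) (y - x) + \<beta> / 2 * (norm (y - x))\<^sup>2"
proof -
  define v where "v = y - x"
  \<comment> \<open>Up to the constant \<open>\<phi> x\<close>, this is \<open>\<phi>\<close> minus
    its quadratic upper model along the segment. Cauchy-Schwarz and the Lipschitz bound make its
    derivative nonpositive on [0, 1].\<close>
  define \<psi> where "\<psi> t = \<phi> (x + t *\<^sub>R v) - t * inner (G x) v - \<beta> / 2 * t\<^sup>2 * (norm v)\<^sup>2" for t
  have v: "v \<in> W" using W by (simp add: v_def subspace_diff)
  have p: "x + t *\<^sub>R v \<in> W" for t using W v by (auto intro: subspace_add subspace_mul)
  have d: "(\<psi> has_real_derivative
      inner (G (x + t *\<^sub>R v)) v - inner (G x) v - \<beta> * t * (norm v)\<^sup>2) (at t)" for t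
    unfolding \<psi>_def
    by (auto intro!: derivative_eq_intros line_derivative[OF W(1,2) v]
        simp: G[unfolded is_gradient_def, rule_format, OF p])
  have "\<psi> 1 \<le> \<psi> 0"
  proof (rule DERIV_nonpos_imp_nonincreasing[of 0 1 \<psi>])
    fix t :: real assume t: "0 \<le> t" "t \<le> 1"
    have "inner (G (x + t *\<^sub>R v)) v - inner (G x) v = inner (G (x + t *\<^sub>R v) - G x) v"
      by (simp add: inner_diff_left)
    also have "\<dots> \<le> norm (G (x + t *\<^sub>R v) - G x) * norm v" by (rule norm_cauchy_schwarz)
    also have "\<dots> \<le> (\<beta> * norm (t *\<^sub>R v)) * norm v"
      using lip[OF p[of t] W(2)] by (intro mult_right_mono) auto
    also have "\<dots> = \<beta> * t * (norm v)\<^sup>2" using t by (simp add: power2_eq_square)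
    finally show "\<exists>z. DERIV \<psi> t :> z \<and> z \<le> 0" using d[of t] by (intro exI conjI) auto
  qed simp
  then show ?thesis by (simp add: \<psi>_def v_def)
qed

lemma convex_above_tangent:
  fixes \<phi> :: "'a::real_inner \<Rightarrow> real"
  assumes W: "subspace W" "x \<in> W" "y \<in> W" and G: "is_gradient W \<phi> G" and cvx: "convex_on W \<phi>"
  shows "\<phi> y \<ge> \<phi> x + inner (G x) (y - x)"
proof -
  define v where "v = y - x"
  have v: "v \<in> W" using W by (simp add: v_def subspace_diff)
  have p: "x + t *\<^sub>R v \<in> W" for t using W v by (auto intro: subspace_add subspace_mul)
  have d: "((\<lambda>t. \<phi> (x + t *\<^sub>R v)) has_real_derivative inner (G x) v) (at 0)"
    using line_derivative[OF W(1,2) v, of \<phi> "G x" 0] G W(2) by (simp add: is_gradient_def)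
  have c: "convex_on UNIV (\<lambda>t. \<phi> (x + t *\<^sub>R v))"
  proof (rule convex_onI)
    fix t a b :: real assume t: "0 < t" "t < 1"
    have eq: "x + ((1 - t) *\<^sub>R a + t *\<^sub>R b) *\<^sub>R v = (1 - t) *\<^sub>R (x + a *\<^sub>R v) + t *\<^sub>R (x + b *\<^sub>R v)"
      by (simp add: algebra_simps)
    show "\<phi> (x + ((1 - t) *\<^sub>R a + t *\<^sub>R b) *\<^sub>R v)
        \<le> (1 - t) * \<phi> (x + a *\<^sub>R v) + t * \<phi> (x + b *\<^sub>R v)"
      unfolding eq using t p by (intro convex_onD[OF cvx]) auto
  qed simp
  have "inner (G x) v * (1 - 0) \<le> \<phi> (x + 1 *\<^sub>R v) - \<phi> (x + 0 *\<^sub>R v)"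
    by (rule convex_on_imp_above_tangent[OF c]) (use d in auto)
  then show ?thesis by (simp add: v_def)
qed

text \<open>Applied with \<open>x\<close> the averaged point and \<open>y\<close> the anchor. The
  right-hand side is linear in \<open>\<phi>\<close> and its gradient, so averaging over the
  components gives the same expression for \<open>favg\<close>.\<close>

lemma gradient_difference_le_bregman:
  fixes \<phi> :: "'a::real_inner \<Rightarrow> real"
  assumes W: "subspace W" "x \<in> W" "y \<in> W" and G: "is_gradient W \<phi> G" and cvx: "convex_on W \<phi>"
    and \<beta>: "\<beta> > 0"
    and lip: "\<And>x y. x \<in> W \<Longrightarrow> y \<in> W \<Longrightarrow> norm (G x - G y) \<le> \<beta> * norm (x - y)"
  shows "(norm (G x - G y))\<^sup>2 \<le> 2 * \<beta> * (\<phi> y - \<phi> x - inner (G x) (y - x))"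
proof -
  define D where "D = G y - G x"
  \<comment> \<open>\<open>z\<close> minimises the quadratic upper model at \<open>y\<close> of \<open>\<phi> - \<langle>G x, \<cdot>\<rangle>\<close>, a function minimal at \<open>x\<close>.\<close>
  define z where "z = y - (1 / \<beta>) *\<^sub>R D"
  have D: "D \<in> W" using W G by (auto simp: D_def is_gradient_def intro: subspace_diff)
  then have z: "z \<in> W" using W by (auto simp: z_def intro: subspace_diff subspace_mul)
  have "\<phi> z \<ge> \<phi> x + inner (G x) (z - x)" by (rule convex_above_tangent[OF W(1,2) z G cvx])
  moreover have "\<phi> z \<le> \<phi> y + inner (G y) (z - y) + \<beta> / 2 * (norm (z - y))\<^sup>2"
    by (rule descent_lemma[OF W(1,3) z G lip])
  moreover have "inner (G x) (z - x) = inner (G x) (y - x) - inner (G x) D / \<beta>"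
    by (simp add: z_def inner_diff_right)
  moreover have "inner (G y) (z - y) = - (inner (G y) D / \<beta>)" by (simp add: z_def)
  moreover have "\<beta> / 2 * (norm (z - y))\<^sup>2 = (norm D)\<^sup>2 / (2 * \<beta>)"
    using \<beta> by (simp add: z_def power2_eq_square)
  moreover have "inner (G y) D / \<beta> - inner (G x) D / \<beta> = (norm D)\<^sup>2 / \<beta>"
    by (simp add: D_def diff_divide_distrib[symmetric] inner_diff_left[symmetric] power2_norm_eq_inner)
  ultimately have "(norm D)\<^sup>2 / \<beta> - (norm D)\<^sup>2 / (2 * \<beta>) \<le> \<phi> y - \<phi> x - inner (G x) (y - x)"
    by linarith
  moreover have "(norm D)\<^sup>2 / \<beta> - (norm D)\<^sup>2 / (2 * \<beta>) = (norm D)\<^sup>2 / (2 * \<beta>)"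
    using \<beta> by (simp add: field_simps)
  ultimately show ?thesis using \<beta> by (simp add: D_def norm_minus_commute pos_divide_le_eq mult.commute)
qed

section \<open>Minimality in a proximal step\<close>

lemma norm_convex_combination:
  fixes p q :: "'a::real_inner"
  shows "(norm ((1 - \<theta>) *\<^sub>R p + \<theta> *\<^sub>R q))\<^sup>2
    = (1 - \<theta>) * (norm p)\<^sup>2 + \<theta> * (norm q)\<^sup>2 - \<theta> * (1 - \<theta>) * (norm (q - p))\<^sup>2"
  by (simp add: power2_norm_eq_inner inner_add_left inner_add_right inner_diff_left
      inner_diff_right inner_commute[of q p] algebra_simps)

text \<open>Strong convexity without subgradients of \<open>h\<close>: comparing the minimiser with
  the point at fraction \<open>\<theta>\<close> towards \<open>y\<close> and dividing by
  \<open>\<theta>\<close> gives the claim with an error \<open>\<theta> * N\<close>.\<close>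

lemma prox_three_point:
  fixes h :: "'a::real_inner \<Rightarrow> real"
  assumes z: "is_arg_min (\<lambda>z. inner g z + h z + M * (norm (z - x))\<^sup>2) (\<lambda>z. z \<in> X) z"
    and X: "convex X" "y \<in> X" and h: "convex_on X h"
  shows "inner g z + h z + M * (norm (z - x))\<^sup>2 + M * (norm (y - z))\<^sup>2
    \<le> inner g y + h y + M * (norm (y - x))\<^sup>2"
proof -
  define P where "P z = inner g z + h z + M * (norm (z - x))\<^sup>2" for z
  have zX: "z \<in> X" and zmin: "\<And>w. w \<in> X \<Longrightarrow> P z \<le> P w"
    using z by (auto simp: is_arg_min_linorder P_def)
  define N where "N = M * (norm (y - z))\<^sup>2"
  have *: "P z + N - P y \<le> \<theta> * N" if \<theta>: "0 < \<theta>" "\<theta> < 1" for \<theta>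
  proof -
    define w where "w = (1 - \<theta>) *\<^sub>R z + \<theta> *\<^sub>R y"
    have "w \<in> X" unfolding w_def using \<theta> X zX by (intro convexD) auto
    then have "P z \<le> P w" by (rule zmin)
    have gw: "inner g w = (1 - \<theta>) * inner g z + \<theta> * inner g y"
      by (simp add: w_def inner_add_right)
    have "w - x = (1 - \<theta>) *\<^sub>R (z - x) + \<theta> *\<^sub>R (y - x)"
      by (simp add: w_def algebra_simps)
    then have nw: "(norm (w - x))\<^sup>2 = (1 - \<theta>) * (norm (z - x))\<^sup>2 + \<theta> * (norm (y - x))\<^sup>2
        - \<theta> * (1 - \<theta>) * (norm (y - z))\<^sup>2"
      using norm_convex_combination[of \<theta> "z - x" "y - x"] by simp
    then have "P w = (1 - \<theta>) * (inner g z + M * (norm (z - x))\<^sup>2)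
        + \<theta> * (inner g y + M * (norm (y - x))\<^sup>2) - \<theta> * (1 - \<theta>) * N + h w"
      unfolding P_def N_def nw gw by (simp add: algebra_simps)
    with \<open>P z \<le> P w\<close> have "P z \<le> (1 - \<theta>) * (inner g z + M * (norm (z - x))\<^sup>2)
        + \<theta> * (inner g y + M * (norm (y - x))\<^sup>2) - \<theta> * (1 - \<theta>) * N + h w" by simp
    also have "h w \<le> (1 - \<theta>) * h z + \<theta> * h y"
      unfolding w_def by (rule convex_onD[OF h]) (use \<theta> zX X in auto)
    finally have "P z \<le> (1 - \<theta>) * P z + \<theta> * P y - \<theta> * (1 - \<theta>) * N"
      by (simp add: P_def algebra_simps)
    then have "\<theta> * (P z + N - P y) \<le> \<theta> * (\<theta> * N)" by (simp add: algebra_simps)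
    then show ?thesis using \<theta> by simp
  qed
  \<comment> \<open>The error disappears in the limit \<open>\<theta>\<close> to 0 from the
    right.\<close>
  have "P z + N - P y \<le> 0"
  proof (rule tendsto_lowerbound)
    show "((\<lambda>\<theta>::real. \<theta> * N) \<longlongrightarrow> 0) (at_right 0)" by (auto intro!: tendsto_eq_intros)
    show "\<forall>\<^sub>F \<theta> in at_right 0. P z + N - P y \<le> \<theta> * N"
      unfolding eventually_at_right_field using * by (intro exI[of _ 1]) auto
  qed simp
  then show ?thesis by (simp add: P_def N_def)
qed

section \<open>One step\<close>

lemma inner_young:
  fixes e v :: "'a::real_inner"
  assumes "\<mu> > 0"
  shows "inner e v \<le> \<mu> / 2 * (norm e)\<^sup>2 + 1 / (2 * \<mu>) * (norm v)\<^sup>2"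
proof -
  have "0 \<le> (norm (\<mu> *\<^sub>R e - v))\<^sup>2" by simp
  also have "\<dots> = \<mu>\<^sup>2 * (norm e)\<^sup>2 + (norm v)\<^sup>2 - 2 * \<mu> * inner e v"
    using dot_norm_neg[of "\<mu> *\<^sub>R e" v] by (simp add: power_mult_distrib)
  finally have "2 * \<mu> * inner e v \<le> \<mu>\<^sup>2 * (norm e)\<^sup>2 + (norm v)\<^sup>2" by simp
  then have "inner e v \<le> (\<mu>\<^sup>2 * (norm e)\<^sup>2 + (norm v)\<^sup>2) / (2 * \<mu>)"
    using assms by (simp add: pos_le_divide_eq mult.commute)
  also have "\<dots> = \<mu> / 2 * (norm e)\<^sup>2 + 1 / (2 * \<mu>) * (norm v)\<^sup>2"
    using assms by (simp add: field_simps power2_eq_square)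
  finally show ?thesis .
qed

lemma variance_le_second_moment:
  fixes D :: "'i \<Rightarrow> 'a::real_inner"
  assumes "finite A" "A \<noteq> {}"
  shows "(\<Sum>i\<in>A. (norm (D i - (1 / card A) *\<^sub>R sum D A))\<^sup>2) \<le> (\<Sum>i\<in>A. (norm (D i))\<^sup>2)"
proof -
  define m where "m = (1 / card A) *\<^sub>R sum D A"
  have s: "sum D A = card A *\<^sub>R m" using assms by (simp add: m_def)
  have "(\<Sum>i\<in>A. (norm (D i - m))\<^sup>2) = (\<Sum>i\<in>A. (norm (D i))\<^sup>2 - 2 * inner (D i) m + (norm m)\<^sup>2)"
    by (intro sum.cong) (simp_all add: power2_norm_eq_inner inner_diff_left inner_diff_right inner_commute)
  also have "\<dots> = (\<Sum>i\<in>A. (norm (D i))\<^sup>2) - 2 * inner (sum D A) m + card A * (norm m)\<^sup>2"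
    by (simp add: sum.distrib sum_subtractf sum_distrib_left[symmetric] inner_sum_left)
  also have "\<dots> = (\<Sum>i\<in>A. (norm (D i))\<^sup>2) - card A * (norm m)\<^sup>2"
    by (simp add: s power2_norm_eq_inner)
  also have "\<dots> \<le> (\<Sum>i\<in>A. (norm (D i))\<^sup>2)" by simp
  finally show ?thesis by (simp add: m_def)
qed

section \<open>The composite problem and a single proximal step\<close>

locale vrag_problem =
  fixes d n :: nat and \<beta> :: real and X :: "fsvec set" and f :: "nat \<Rightarrow> fsvec \<Rightarrow> real"
    and h :: "fsvec \<Rightarrow> real"
  assumes problem: "composite_problem d n \<beta> X f h"
begin

lemma n_pos: "n \<ge> 1" and beta_pos: "\<beta> > 0" and X_Rd: "X \<subseteq> Rd d" and convex_X: "convex X"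
  and convex_h: "convex_on X h"
  and convex_f: "\<And>i. i \<in> {1..n} \<Longrightarrow> convex_on (Rd d) (f i)"
  and diff_f: "\<And>i. i \<in> {1..n} \<Longrightarrow> f i differentiable_on Rd d"
  and lipschitz_f: "\<And>i x y. i \<in> {1..n} \<Longrightarrow> x \<in> Rd d \<Longrightarrow> y \<in> Rd d \<Longrightarrow>
    norm (grad d (f i) x - grad d (f i) y) \<le> \<beta> * norm (x - y)"
  and prox_ex: "\<And>\<eta> v. \<eta> \<ge> 0 \<Longrightarrow> v \<in> Rd d \<Longrightarrow>
    \<exists>x. is_arg_min (\<lambda>x. \<eta> * h x + 1/2 * (norm (x - v))\<^sup>2) (\<lambda>x. x \<in> X) x"
  using problem by (auto simp: composite_problem_def)

lemma gradient_f: "i \<in> {1..n} \<Longrightarrow> is_gradient (Rd d) (f i) (grad d (f i))"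
  by (intro is_gradient_grad diff_f)

lemma grad_favg_eq:
  assumes "x \<in> Rd d"
  shows "grad d (favg n f) x = (1 / real n) *\<^sub>R (\<Sum>i=1..n. grad d (f i) x)"
  using is_gradient_favg[of n d f, OF gradient_f] assms
  by (intro grad_eqI) (auto simp: is_gradient_def)

lemma gradient_favg: "is_gradient (Rd d) (favg n f) (grad d (favg n f))"
  using is_gradient_favg[of n d f, OF gradient_f] by (simp add: is_gradient_def grad_favg_eq)

lemma lipschitz_favg:
  assumes "x \<in> Rd d" "y \<in> Rd d"
  shows "norm (grad d (favg n f) x - grad d (favg n f) y) \<le> \<beta> * norm (x - y)"
proof -
  have "norm (grad d (favg n f) x - grad d (favg n f) y)
      = (1 / real n) * norm (\<Sum>i=1..n. grad d (f i) x - grad d (f i) y)"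
    by (simp add: grad_favg_eq assms sum_subtractf scaleR_diff_right[symmetric])
  also have "\<dots> \<le> (1 / real n) * (\<Sum>i=1..n. \<beta> * norm (x - y))"
    using lipschitz_f assms by (intro mult_left_mono sum_norm_le) auto
  also have "\<dots> = \<beta> * norm (x - y)" using n_pos by simp
  finally show ?thesis .
qed

lemma convex_favg: "convex_on (Rd d) (favg n f)"
  unfolding favg_def[abs_def]
  by (intro convex_on_cmul convex_on_sum_fun subspace_imp_convex subspace_Rd convex_f) auto

lemma convex_objective: "convex_on X (objective n f h)"
  unfolding objective_def[abs_def]
  by (intro convex_on_add convex_h convex_on_subset[OF convex_favg X_Rd] convex_X)

text \<open>Completing the square around \<open>v = x - g / (2 M)\<close> shows that the minimised
  function is \<open>2 M\<close> times the prox objective with \<open>\<eta> = 1 / (2 M)\<close>,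
  plus a constant. The existence assumption of the problem thus carries over, and the choice made by
  \<open>arg_min_on\<close> is a true minimiser.\<close>

lemma prox_is_arg_min:
  assumes "M > 0" "x \<in> Rd d" "g \<in> Rd d"
  shows "is_arg_min (\<lambda>z. inner g z + h z + M * (norm (z - x))\<^sup>2) (\<lambda>z. z \<in> X)
    (arg_min_on (\<lambda>z. inner g z + h z + M * (norm (z - x))\<^sup>2) X)"
proof -
  define v where "v = x - (1 / (2 * M)) *\<^sub>R g"
  define P where "P z = inner g z + h z + M * (norm (z - x))\<^sup>2" for z
  define c where "c = M * (norm x)\<^sup>2 - M * (norm v)\<^sup>2"
  have "v \<in> Rd d"
    using assms by (auto simp: v_def intro!: subspace_diff subspace_mul subspace_Rd)
  then obtain z0 where z0: "is_arg_min (\<lambda>x. 1 / (2 * M) * h x + 1/2 * (norm (x - v))\<^sup>2) (\<lambda>x. x \<in> X) z0"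
    using prox_ex[of "1 / (2 * M)" v] assms by auto
  have P: "P z = 2 * M * (1 / (2 * M) * h z + 1/2 * (norm (z - v))\<^sup>2) + c" for z
  proof -
    have v: "2 * M * inner v z = 2 * M * inner x z - inner g z"
      using assms by (simp add: v_def inner_diff_left right_diff_distrib)
    have sq: "M * (norm (z - y))\<^sup>2 = M * (norm y)\<^sup>2 + M * (norm z)\<^sup>2 - 2 * M * inner y z" for y
    proof -
      have eq: "(norm (z - y))\<^sup>2 = (norm y)\<^sup>2 + (norm z)\<^sup>2 - 2 * inner y z"
        using dot_norm_neg[of y z] by (simp add: norm_minus_commute[of z])
      show ?thesis unfolding eq by (simp add: algebra_simps)
    qed
    have "2 * M * (1 / (2 * M) * h z + 1/2 * N) = h z + M * N" for N
      using assms(1) by (simp add: distrib_left)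
    then show ?thesis using v by (simp add: P_def c_def sq)
  qed
  have "is_arg_min P (\<lambda>z. z \<in> X) z0"
    unfolding is_arg_min_linorder P
    using z0 assms by (auto simp: is_arg_min_linorder intro!: mult_left_mono)
  then show ?thesis
    unfolding arg_min_on_def arg_min_def P_def by (rule someI)
qed

text \<open>The recursion step of \<open>vrag_inner\<close> as a function of the drawn index alone,
  so that the index can be averaged with \<open>u\<close> and \<open>x\<close> held fixed.\<close>

definition prox_step :: "real \<Rightarrow> fsvec \<Rightarrow> fsvec \<Rightarrow> nat \<Rightarrow> fsvec"
  where "prox_step a u x i = arg_min_on (\<lambda>z. inner (grad_estimate d n f u (a *\<^sub>R x + (1 - a) *\<^sub>R u) i) z
    + h z + \<beta> * (2 - a) * a / (2 * (1 - a)) * (norm (z - x))\<^sup>2) X"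

lemma prox_step_is_arg_min:
  assumes "0 < a" "a < 1" "u \<in> X" "x \<in> X" "i \<in> {1..n}"
  shows "is_arg_min (\<lambda>z. inner (grad_estimate d n f u (a *\<^sub>R x + (1 - a) *\<^sub>R u) i) z
    + h z + \<beta> * (2 - a) * a / (2 * (1 - a)) * (norm (z - x))\<^sup>2) (\<lambda>z. z \<in> X) (prox_step a u x i)"
  unfolding prox_step_def
proof (rule prox_is_arg_min)
  show "0 < \<beta> * (2 - a) * a / (2 * (1 - a))" using assms beta_pos by auto
  have "a *\<^sub>R x + (1 - a) *\<^sub>R u \<in> X" using assms by (intro convexD[OF convex_X]) auto
  then show "grad_estimate d n f u (a *\<^sub>R x + (1 - a) *\<^sub>R u) i \<in> Rd d"
    unfolding grad_estimate_def
    using gradient_f[OF assms(5)] gradient_favg X_Rd assms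
    by (auto simp: is_gradient_def intro!: subspace_add subspace_diff subspace_Rd)
qed (use assms X_Rd in auto)

lemma prox_step_in:
  assumes "0 < a" "a < 1" "u \<in> X" "x \<in> X" "i \<in> {1..n}"
  shows "prox_step a u x i \<in> X"
  using prox_step_is_arg_min[OF assms] by (simp add: is_arg_min_def)

text \<open>A deterministic bound for each fixed index. The noise is confined to \<open>g\<close>;
  the coefficient \<open>(1 - a) / (2 \<beta>)\<close> of its square will cancel the factor
  \<open>2 \<beta>\<close> of the variance bound and leave \<open>1 - a\<close>.\<close>

lemma prox_step_bound:
  assumes a: "0 < a" "a < 1" and ux: "u \<in> X" "x \<in> X" "y \<in> X" and i: "i \<in> {1..n}"
  defines "w \<equiv> \<beta> * (2 - a) * a\<^sup>2 / (2 * (1 - a))" and "xbar \<equiv> a *\<^sub>R x + (1 - a) *\<^sub>R u"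
    and "x' \<equiv> prox_step a u x i"
  defines "g \<equiv> grad_estimate d n f u xbar i"
  shows "objective n f h (a *\<^sub>R x' + (1 - a) *\<^sub>R u) + w * (norm (y - x'))\<^sup>2
    \<le> favg n f xbar + a * inner g (y - x) + a * h y + (1 - a) * h u + w * (norm (y - x))\<^sup>2
      + (1 - a) / (2 * \<beta>) * (norm (grad d (favg n f) xbar - g))\<^sup>2"
proof -
  define M where "M = \<beta> * (2 - a) * a / (2 * (1 - a))"
  define D where "D = grad d (favg n f) xbar"
  have wM: "w = a * M" by (simp add: w_def M_def power2_eq_square)
  have x': "x' \<in> X" unfolding x'_def by (rule prox_step_in[OF a ux(1,2) i])
  have xb: "xbar \<in> X" "a *\<^sub>R x' + (1 - a) *\<^sub>R u \<in> X"
    unfolding xbar_def using a ux x' by (auto intro!: convexD[OF convex_X])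
  have diff: "a *\<^sub>R x' + (1 - a) *\<^sub>R u - xbar = a *\<^sub>R (x' - x)"
    by (simp add: xbar_def algebra_simps)
  have "favg n f (a *\<^sub>R x' + (1 - a) *\<^sub>R u)
      \<le> favg n f xbar + inner D (a *\<^sub>R (x' - x)) + \<beta> / 2 * (norm (a *\<^sub>R (x' - x)))\<^sup>2"
    using descent_lemma[OF subspace_Rd _ _ gradient_favg lipschitz_favg,
        of xbar "a *\<^sub>R x' + (1 - a) *\<^sub>R u"] xb X_Rd
    unfolding D_def diff by blast
  also have "inner D (a *\<^sub>R (x' - x)) = a * inner g (x' - x) + inner (D - g) (a *\<^sub>R (x' - x))"
    by (simp add: inner_diff_left algebra_simps)
  \<comment> \<open>The Young parameter \<open>(1 - a) / \<beta>\<close> is chosen so that the two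
    quadratic coefficients, times \<open>a^2\<close>, add up to \<open>w\<close>.\<close>
  also have "inner (D - g) (a *\<^sub>R (x' - x)) \<le> ((1 - a) / \<beta>) / 2 * (norm (D - g))\<^sup>2
      + 1 / (2 * ((1 - a) / \<beta>)) * (norm (a *\<^sub>R (x' - x)))\<^sup>2"
    using a beta_pos by (intro inner_young) auto
  finally have "favg n f (a *\<^sub>R x' + (1 - a) *\<^sub>R u) \<le> favg n f xbar + a * inner g (x' - x)
      + (1 - a) / (2 * \<beta>) * (norm (D - g))\<^sup>2
      + (\<beta> / 2 + \<beta> / (2 * (1 - a))) * (norm (a *\<^sub>R (x' - x)))\<^sup>2"
    by (simp add: algebra_simps)
  also have "(\<beta> / 2 + \<beta> / (2 * (1 - a))) * (norm (a *\<^sub>R (x' - x)))\<^sup>2 = w * (norm (x' - x))\<^sup>2"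
  proof -
    have "(\<beta> / 2 + \<beta> / (2 * (1 - a))) * a\<^sup>2 = w"
      unfolding w_def using a by (simp add: field_simps)
    then show ?thesis by (simp add: power_mult_distrib mult.assoc[symmetric])
  qed
  finally have F: "favg n f (a *\<^sub>R x' + (1 - a) *\<^sub>R u) \<le> favg n f xbar + a * inner g (x' - x)
      + (1 - a) / (2 * \<beta>) * (norm (D - g))\<^sup>2 + w * (norm (x' - x))\<^sup>2" .
  have "inner g x' + h x' + M * (norm (x' - x))\<^sup>2 + M * (norm (y - x'))\<^sup>2
      \<le> inner g y + h y + M * (norm (y - x))\<^sup>2"
    unfolding M_def x'_def g_def xbar_def
    by (rule prox_three_point[OF prox_step_is_arg_min[OF a ux(1,2) i] convex_X ux(3) convex_h])
  \<comment> \<open>Scaling by \<open>a\<close> turns \<open>M\<close> into \<open>w\<close>, so the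
    term in \<open>x' - x\<close> cancels against the one in \<open>F\<close>.\<close>
  then have "a * (inner g x' + h x' + M * (norm (x' - x))\<^sup>2 + M * (norm (y - x'))\<^sup>2)
      \<le> a * (inner g y + h y + M * (norm (y - x))\<^sup>2)"
    using a by (intro mult_left_mono) auto
  then have P: "a * inner g (x' - x) + a * h x' + w * (norm (x' - x))\<^sup>2 + w * (norm (y - x'))\<^sup>2
      \<le> a * inner g (y - x) + a * h y + w * (norm (y - x))\<^sup>2"
    by (simp add: wM inner_diff_right algebra_simps)
  have "h (a *\<^sub>R x' + (1 - a) *\<^sub>R u) \<le> a * h x' + (1 - a) * h u"
    using convex_h a x' ux by (auto simp: convex_on_def)
  with F P show ?thesis unfolding objective_def D_def by linarith
qed

text \<open>The estimate is unbiased, so averaging replaces \<open>g\<close> by the full gradient at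
  the averaged point. The Bregman form of the variance bound brings a negative inner product,
  exactly the one needed to move the tangent from \<open>x\<close> to the averaged point.\<close>

lemma prox_step_expectation:
  assumes a: "0 < a" "a < 1" and ux: "u \<in> X" "x \<in> X" "y \<in> X"
  defines "w \<equiv> \<beta> * (2 - a) * a\<^sup>2 / (2 * (1 - a))"
  shows "(1 / real n) * (\<Sum>i=1..n. objective n f h (a *\<^sub>R prox_step a u x i + (1 - a) *\<^sub>R u)
        + w * (norm (y - prox_step a u x i))\<^sup>2)
    \<le> (1 - a) * objective n f h u + a * objective n f h y + w * (norm (y - x))\<^sup>2"
proof -
  define xbar where "xbar = a *\<^sub>R x + (1 - a) *\<^sub>R u"
  define D where "D = grad d (favg n f) xbar"
  define g where "g i = grad_estimate d n f u xbar i" for i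
  define \<delta> where "\<delta> i = grad d (f i) xbar - grad d (f i) u" for i
  have xb: "xbar \<in> X" unfolding xbar_def using a ux by (intro convexD[OF convex_X]) auto
  then have Rd: "xbar \<in> Rd d" "u \<in> Rd d" "y \<in> Rd d" using X_Rd ux by auto
  have mean_\<delta>: "(1 / real n) *\<^sub>R (\<Sum>i=1..n. \<delta> i) = D - grad d (favg n f) u"
    by (simp add: \<delta>_def D_def grad_favg_eq Rd sum_subtractf scaleR_diff_right)
  have g\<delta>: "g i = \<delta> i + grad d (favg n f) u" for i
    by (simp add: g_def \<delta>_def grad_estimate_def)
  have mean_g: "(1 / real n) *\<^sub>R (\<Sum>i=1..n. g i) = D"
    using mean_\<delta> n_pos by (simp add: g\<delta> sum.distrib scaleR_add_right sum_constant_scaleR)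
  \<comment> \<open>The full gradient at the anchor cancels, leaving the deviation of
    \<open>\<delta> i\<close> from its mean.\<close>
  have "(\<Sum>i=1..n. (norm (D - g i))\<^sup>2)
      = (\<Sum>i=1..n. (norm (\<delta> i - (1 / card {1..n}) *\<^sub>R (\<Sum>i=1..n. \<delta> i)))\<^sup>2)"
    by (intro sum.cong refl) (simp add: mean_\<delta>[simplified] g\<delta> norm_minus_commute algebra_simps)
  also have "\<dots> \<le> (\<Sum>i=1..n. (norm (\<delta> i))\<^sup>2)"
    using n_pos by (intro variance_le_second_moment) auto
  also have "\<dots> \<le> (\<Sum>i=1..n. 2 * \<beta> * (f i u - f i xbar - inner (grad d (f i) xbar) (u - xbar)))"
    unfolding \<delta>_def using Rd convex_f lipschitz_f gradient_f beta_pos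
    by (intro sum_mono gradient_difference_le_bregman[OF subspace_Rd]) auto
  finally have "(1 / real n) * (\<Sum>i=1..n. (norm (D - g i))\<^sup>2)
      \<le> (1 / real n) * (\<Sum>i=1..n. 2 * \<beta> * (f i u - f i xbar - inner (grad d (f i) xbar) (u - xbar)))"
    by (intro mult_left_mono) auto
  also have "\<dots> = 2 * \<beta> * (favg n f u - favg n f xbar - inner D (u - xbar))"
    unfolding D_def grad_favg_eq[OF Rd(1)] favg_def
    by (simp only: sum_subtractf sum_distrib_left[symmetric] inner_sum_left inner_scaleR_left)
      (simp add: right_diff_distrib diff_divide_distrib)
  finally have var: "(1 / real n) * (\<Sum>i=1..n. (norm (D - g i))\<^sup>2)
      \<le> 2 * \<beta> * (favg n f u - favg n f xbar - inner D (u - xbar))" .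
  let ?c = "favg n f xbar + a * h y + (1 - a) * h u + w * (norm (y - x))\<^sup>2"
  have "(1 / real n) * (\<Sum>i=1..n. objective n f h (a *\<^sub>R prox_step a u x i + (1 - a) *\<^sub>R u)
        + w * (norm (y - prox_step a u x i))\<^sup>2)
      \<le> (1 / real n) * (\<Sum>i=1..n. ?c + a * inner (g i) (y - x)
        + (1 - a) / (2 * \<beta>) * (norm (D - g i))\<^sup>2)"
    using prox_step_bound[OF a ux]
    by (intro mult_left_mono sum_mono) (auto simp: w_def D_def g_def xbar_def algebra_simps)
  also have "\<dots> = ?c + a * ((1 / real n) * (\<Sum>i=1..n. inner (g i) (y - x)))
      + (1 - a) / (2 * \<beta>) * ((1 / real n) * (\<Sum>i=1..n. (norm (D - g i))\<^sup>2))"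
    using n_pos by (simp add: sum.distrib distrib_left sum_distrib_left[symmetric]
        sum_divide_distrib[symmetric] mult.commute)
  also have "(1 / real n) * (\<Sum>i=1..n. inner (g i) (y - x)) = inner D (y - x)"
    by (simp add: mean_g[symmetric] inner_sum_left)
  also have "(1 - a) / (2 * \<beta>) * ((1 / real n) * (\<Sum>i=1..n. (norm (D - g i))\<^sup>2))
      \<le> (1 - a) / (2 * \<beta>) * (2 * \<beta> * (favg n f u - favg n f xbar - inner D (u - xbar)))"
    using a beta_pos by (intro mult_left_mono var) auto
  also have "\<dots> = (1 - a) * (favg n f u - favg n f xbar - inner D (u - xbar))"
    using beta_pos by simp
  finally have "(1 / real n) * (\<Sum>i=1..n. objective n f h (a *\<^sub>R prox_step a u x i + (1 - a) *\<^sub>R u)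
        + w * (norm (y - prox_step a u x i))\<^sup>2)
      \<le> ?c + a * inner D (y - x) + (1 - a) * (favg n f u - favg n f xbar - inner D (u - xbar))"
    by simp
  \<comment> \<open>Because \<open>a x + (1 - a) u\<close> is \<open>xbar\<close>, the two inner
    products merge into one tangent term at \<open>xbar\<close>, to which convexity applies.\<close>
  also have "a * inner D (y - x) - (1 - a) * inner D (u - xbar) = a * inner D (y - xbar)"
    by (simp add: xbar_def inner_diff_right inner_add_right algebra_simps)
  then have "?c + a * inner D (y - x) + (1 - a) * (favg n f u - favg n f xbar - inner D (u - xbar))
    = (1 - a) * (favg n f u + h u) + a * (favg n f xbar + inner D (y - xbar)) + a * h y
      + w * (norm (y - x))\<^sup>2"
    by (simp add: algebra_simps)
  also have "favg n f xbar + inner D (y - xbar) \<le> favg n f y"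
    unfolding D_def by (rule convex_above_tangent[OF subspace_Rd Rd(1,3) gradient_favg convex_favg])
  finally show ?thesis using a by (simp add: objective_def algebra_simps)
qed

end

section \<open>One epoch\<close>

lemma finite_set_Pi_pmf:
  assumes "finite A" "\<And>x. x \<in> A \<Longrightarrow> finite (set_pmf (q x))"
  shows "finite (set_pmf (Pi_pmf A dflt q))"
  using assms by (auto simp: set_Pi_pmf)

text \<open>Overwriting coordinate \<open>p\<close> discards its old draw, so an independent redraw
  leaves the product law unchanged. This takes the place of conditioning on the past.\<close>

lemma expectation_Pi_pmf_resample:
  fixes \<Phi> :: "('a \<Rightarrow> 'b) \<Rightarrow> real"
  assumes A: "finite A" "p \<in> A" and fin: "\<And>x. x \<in> A \<Longrightarrow> finite (set_pmf (q x))"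
  shows "measure_pmf.expectation (Pi_pmf A dflt q) \<Phi>
    = measure_pmf.expectation (Pi_pmf A dflt q)
        (\<lambda>\<omega>. measure_pmf.expectation (q p) (\<lambda>i. \<Phi> (\<omega> (p := i))))"
proof -
  let ?P = "Pi_pmf A dflt q" and ?P' = "Pi_pmf (A - {p}) dflt q"
  have "insert p (A - {p}) = A" using A by auto
  then have P: "?P = bind_pmf (q p) (\<lambda>y. bind_pmf ?P' (\<lambda>\<omega>. return_pmf (\<omega> (p := y))))"
    using Pi_pmf_insert'[of "A - {p}" p dflt q] A by simp
  have "bind_pmf ?P (\<lambda>\<omega>. map_pmf (\<lambda>i. \<omega> (p := i)) (q p))
      = bind_pmf ?P' (\<lambda>\<omega>. bind_pmf (q p) (\<lambda>i. return_pmf (\<omega> (p := i))))"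
    unfolding P by (simp add: bind_assoc_pmf bind_return_pmf map_pmf_def)
  also have "\<dots> = ?P" unfolding P by (rule bind_commute_pmf)
  finally have "measure_pmf.expectation ?P \<Phi>
      = measure_pmf.expectation (bind_pmf ?P (\<lambda>\<omega>. map_pmf (\<lambda>i. \<omega> (p := i)) (q p))) \<Phi>" by simp
  also have "\<dots> = (\<Sum>\<omega>\<in>set_pmf ?P. pmf ?P \<omega> *\<^sub>R
      measure_pmf.expectation (map_pmf (\<lambda>i. \<omega> (p := i)) (q p)) \<Phi>)"
    using A fin by (intro pmf_expectation_bind finite_set_Pi_pmf) auto
  also have "\<dots> = measure_pmf.expectation ?P
      (\<lambda>\<omega>. measure_pmf.expectation (q p) (\<lambda>i. \<Phi> (\<omega> (p := i))))"
    using A fin by (subst integral_measure_pmf_real[of "set_pmf ?P"])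
      (auto intro!: finite_set_Pi_pmf simp: mult.commute)
  finally show ?thesis .
qed

lemma vrag_inner_cong:
  assumes "\<And>k. k \<le> t \<Longrightarrow> j k = j' k"
  shows "vrag_inner d n \<beta> X f h a u x0 j t = vrag_inner d n \<beta> X f h a u x0 j' t"
  using assms by (induction t) simp_all

lemma vrag_state_cong:
  assumes "\<And>s t. s \<le> m \<Longrightarrow> \<omega> (s, t) = \<omega>' (s, t)"
  shows "vrag_state d n \<beta> X f h a T u0 \<omega> m = vrag_state d n \<beta> X f h a T u0 \<omega>' m"
  using assms
proof (induction m)
  case (Suc m)
  have "(\<lambda>t. \<omega> (Suc m, t)) = (\<lambda>t. \<omega>' (Suc m, t))" using Suc.prems by auto
  then show ?case using Suc by simp
qed simp

section \<open>A run of the algorithm under the law of its draws\<close>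

locale vrag_run = vrag_problem +
  fixes a :: "nat \<Rightarrow> real" and u0 :: fsvec and S :: nat
  assumes a: "\<And>s. s \<ge> 1 \<Longrightarrow> 0 < a s \<and> a s < 1" and u0: "u0 \<in> X"
begin

abbreviation draws where "draws \<equiv> vrag_draws n (\<lambda>_. n) S"

text \<open>All epochs are analysed under the one law of the indices of \<open>S\<close> epochs, so
  that the inequalities of successive epochs can be chained.\<close>

abbreviation E :: "((nat \<times> nat \<Rightarrow> nat) \<Rightarrow> real) \<Rightarrow> real"
  where "E \<equiv> measure_pmf.expectation draws"

definition anchor where "anchor \<omega> s = fst (vrag_state d n \<beta> X f h a (\<lambda>_. n) u0 \<omega> s)"

text \<open>The epoch is counted from 0 here: \<open>iterate \<omega> s t\<close> belongs to epoch
  \<open>Suc s\<close>, which starts from the state after \<open>s\<close> epochs.\<close>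

definition iterate where "iterate \<omega> s t =
  vrag_inner d n \<beta> X f h (a (Suc s)) (anchor \<omega> s) (snd (vrag_state d n \<beta> X f h a (\<lambda>_. n) u0 \<omega> s))
    (\<lambda>t. \<omega> (Suc s, t)) t"

lemma finite_draws: "finite (set_pmf draws)"
  unfolding vrag_draws_def using n_pos by (intro finite_set_Pi_pmf) auto

lemma integrable_draws [simp]: "integrable draws \<Phi>" for \<Phi> :: "_ \<Rightarrow> real"
  by (rule integrable_measure_pmf_finite[OF finite_draws])

lemma draws_in_range:
  assumes "\<omega> \<in> set_pmf draws" "s \<in> {1..S}" "t \<in> {1..n}"
  shows "\<omega> (s, t) \<in> {1..n}"
  using assms n_pos by (auto simp: vrag_draws_def set_Pi_pmf PiE_dflt_def)

lemma E_mono: "(\<And>\<omega>. \<omega> \<in> set_pmf draws \<Longrightarrow> \<Phi> \<omega> \<le> \<Psi> \<omega>) \<Longrightarrow> E \<Phi> \<le> E \<Psi>"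
  by (intro integral_mono_AE) (auto simp: AE_measure_pmf_iff)

lemma E_resample:
  assumes "s \<in> {1..S}" "t \<in> {1..n}"
  shows "E \<Phi> = E (\<lambda>\<omega>. (1 / real n) * (\<Sum>i=1..n. \<Phi> (\<omega> ((s, t) := i))))"
proof -
  have "measure_pmf.expectation (pmf_of_set {1..n}) \<Psi> = (1 / real n) * (\<Sum>i=1..n. \<Psi> i)"
    for \<Psi> :: "nat \<Rightarrow> real"
    using n_pos by (simp add: integral_pmf_of_set)
  then show ?thesis
    unfolding vrag_draws_def using assms n_pos
    by (subst expectation_Pi_pmf_resample[of _ "(s, t)"]) auto
qed

lemma anchor_0: "anchor \<omega> 0 = u0" and iterate_0_0: "iterate \<omega> 0 0 = u0"
  by (simp_all add: anchor_def iterate_def)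

lemma iterate_Suc:
  "iterate \<omega> s (Suc t) = prox_step (a (Suc s)) (anchor \<omega> s) (iterate \<omega> s t) (\<omega> (Suc s, Suc t))"
  by (simp add: iterate_def prox_step_def Let_def)

lemma anchor_Suc: "anchor \<omega> (Suc s) =
    (1 / real n) *\<^sub>R (\<Sum>t=1..n. a (Suc s) *\<^sub>R iterate \<omega> s t + (1 - a (Suc s)) *\<^sub>R anchor \<omega> s)"
  by (simp add: anchor_def iterate_def Let_def case_prod_unfold)

lemma iterate_Suc_0: "iterate \<omega> (Suc s) 0 = iterate \<omega> s n"
  by (simp add: anchor_def iterate_def Let_def case_prod_unfold)

lemma average_in_X:
  assumes "\<And>t. t \<in> {1..n} \<Longrightarrow> z t \<in> X"
  shows "(1 / real n) *\<^sub>R (\<Sum>t=1..n. z t) \<in> X"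
  using convex_sum[of "{1..n}" X "\<lambda>_. 1 / real n" z] convex_X n_pos assms
  by (simp add: scaleR_sum_right)

text \<open>\<open>iterate \<omega> s\<close> uses the draws of epoch \<open>Suc s\<close>, hence
  the bound \<open>s < S\<close>: outside the drawn range the index is the default 0, which names no
  component.\<close>

lemma iterates_in_X:
  assumes \<omega>: "\<omega> \<in> set_pmf draws" and "s < S"
  shows "anchor \<omega> s \<in> X \<and> (\<forall>t\<le>n. iterate \<omega> s t \<in> X)"
  using assms(2)
proof (induction s)
  case 0
  have "iterate \<omega> 0 t \<in> X" if "t \<le> n" for t
    using that
  proof (induction t)
    case (Suc t)
    have "\<omega> (Suc 0, Suc t) \<in> {1..n}" using 0 Suc.prems by (intro draws_in_range[OF \<omega>]) auto
    then show ?case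
      unfolding iterate_Suc using Suc a u0 by (intro prox_step_in) (auto simp: anchor_0)
  qed (simp add: iterate_0_0 u0)
  then show ?case by (simp add: anchor_0 u0)
next
  case (Suc s)
  then have IH: "anchor \<omega> s \<in> X" "\<And>t. t \<le> n \<Longrightarrow> iterate \<omega> s t \<in> X" by auto
  have u: "anchor \<omega> (Suc s) \<in> X"
    unfolding anchor_Suc using IH a[of "Suc s"]
    by (intro average_in_X convexD[OF convex_X]) auto
  have "iterate \<omega> (Suc s) t \<in> X" if "t \<le> n" for t
    using that
  proof (induction t)
    case (Suc t)
    have "\<omega> (Suc (Suc s), Suc t) \<in> {1..n}"
      using \<open>Suc s < S\<close> Suc.prems by (intro draws_in_range[OF \<omega>]) auto
    then show ?case
      unfolding iterate_Suc using Suc a u by (intro prox_step_in) auto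
  qed (simp add: iterate_Suc_0 IH)
  then show ?case using u by simp
qed

text \<open>The state after \<open>s\<close> epochs and the first \<open>t\<close> steps of the next
  one read only earlier draws, so redrawing the index of step \<open>Suc t\<close> affects
  neither.\<close>

lemma resample_past:
  "anchor (\<omega> ((Suc s, Suc t) := i)) s = anchor \<omega> s"
  "iterate (\<omega> ((Suc s, Suc t) := i)) s t = iterate \<omega> s t"
proof -
  have *: "vrag_state d n \<beta> X f h a (\<lambda>_. n) u0 (\<omega> ((Suc s, Suc t) := i)) s
      = vrag_state d n \<beta> X f h a (\<lambda>_. n) u0 \<omega> s"
    by (rule vrag_state_cong) auto
  show "anchor (\<omega> ((Suc s, Suc t) := i)) s = anchor \<omega> s"
    by (simp add: anchor_def *)
  then show "iterate (\<omega> ((Suc s, Suc t) := i)) s t = iterate \<omega> s t"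
    unfolding iterate_def * by (auto intro: vrag_inner_cong)
qed

lemma step_expectation:
  assumes s: "s < S" and t: "t < n" and y: "y \<in> X"
  defines "w \<equiv> \<beta> * (2 - a (Suc s)) * (a (Suc s))\<^sup>2 / (2 * (1 - a (Suc s)))"
  shows "E (\<lambda>\<omega>. objective n f h (a (Suc s) *\<^sub>R iterate \<omega> s (Suc t) + (1 - a (Suc s)) *\<^sub>R anchor \<omega> s))
      + w * E (\<lambda>\<omega>. (norm (y - iterate \<omega> s (Suc t)))\<^sup>2)
    \<le> (1 - a (Suc s)) * E (\<lambda>\<omega>. objective n f h (anchor \<omega> s)) + a (Suc s) * objective n f h y
      + w * E (\<lambda>\<omega>. (norm (y - iterate \<omega> s t))\<^sup>2)"
proof -
  let ?F = "objective n f h"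
  let ?p = "(Suc s, Suc t)"
  define \<Phi> where "\<Phi> \<omega> = ?F (a (Suc s) *\<^sub>R iterate \<omega> s (Suc t) + (1 - a (Suc s)) *\<^sub>R anchor \<omega> s)
    + w * (norm (y - iterate \<omega> s (Suc t)))\<^sup>2" for \<omega>
  \<comment> \<open>Redrawing exactly the index of this step exposes the uniform average over
    components, with anchor and previous iterate fixed.\<close>
  have "E \<Phi> = E (\<lambda>\<omega>. (1 / real n) * (\<Sum>i=1..n. \<Phi> (\<omega> (?p := i))))"
    using s t by (intro E_resample) auto
  also have "\<dots> \<le> E (\<lambda>\<omega>. (1 - a (Suc s)) * ?F (anchor \<omega> s) + a (Suc s) * ?F y
      + w * (norm (y - iterate \<omega> s t))\<^sup>2)"
  proof (rule E_mono)
    fix \<omega> assume "\<omega> \<in> set_pmf draws"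
    then have "anchor \<omega> s \<in> X" "iterate \<omega> s t \<in> X" using iterates_in_X s t by auto
    then show "(1 / real n) * (\<Sum>i=1..n. \<Phi> (\<omega> (?p := i)))
        \<le> (1 - a (Suc s)) * ?F (anchor \<omega> s) + a (Suc s) * ?F y + w * (norm (y - iterate \<omega> s t))\<^sup>2"
      unfolding \<Phi>_def iterate_Suc resample_past w_def fun_upd_same
      using a[of "Suc s"] y by (intro prox_step_expectation) auto
  qed
  finally show ?thesis by (simp add: \<Phi>_def[abs_def])
qed

text \<open>Jensen's inequality for the averaged anchor, then summation over the \<open>n\<close>
  steps. The anchor term is the same in every step and keeps its weight under averaging, whereas the
  squared distances telescope and keep only \<open>w / n\<close>.\<close>

lemma epoch_expectation:
  assumes s: "s < S" and y: "y \<in> X"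
  defines "w \<equiv> \<beta> * (2 - a (Suc s)) * (a (Suc s))\<^sup>2 / (2 * (1 - a (Suc s)))"
  shows "E (\<lambda>\<omega>. objective n f h (anchor \<omega> (Suc s)) - objective n f h y)
      + w / n * E (\<lambda>\<omega>. (norm (y - iterate \<omega> s n))\<^sup>2)
    \<le> (1 - a (Suc s)) * E (\<lambda>\<omega>. objective n f h (anchor \<omega> s) - objective n f h y)
      + w / n * E (\<lambda>\<omega>. (norm (y - iterate \<omega> s 0))\<^sup>2)"
proof -
  let ?F = "objective n f h"
  define z where "z \<omega> t = a (Suc s) *\<^sub>R iterate \<omega> s t + (1 - a (Suc s)) *\<^sub>R anchor \<omega> s" for \<omega> t
  define D where "D t = E (\<lambda>\<omega>. (norm (y - iterate \<omega> s t))\<^sup>2)" for t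
  define A where "A = (1 - a (Suc s)) * E (\<lambda>\<omega>. ?F (anchor \<omega> s)) + a (Suc s) * ?F y"
  have "E (\<lambda>\<omega>. ?F (anchor \<omega> (Suc s))) \<le> E (\<lambda>\<omega>. \<Sum>t=1..n. (1 / real n) * ?F (z \<omega> t))"
  proof (rule E_mono)
    fix \<omega> assume \<omega>: "\<omega> \<in> set_pmf draws"
    have "z \<omega> t \<in> X" if "t \<in> {1..n}" for t
      unfolding z_def using iterates_in_X[OF \<omega> s] that a[of "Suc s"]
      by (intro convexD[OF convex_X]) auto
    then show "?F (anchor \<omega> (Suc s)) \<le> (\<Sum>t=1..n. (1 / real n) * ?F (z \<omega> t))"
      using convex_on_sum[of "{1..n}" X ?F "\<lambda>_. 1 / real n" "z \<omega>"] convex_objective n_pos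
      unfolding anchor_Suc z_def[symmetric] by (simp add: scaleR_sum_right)
  qed
  also have "\<dots> = (1 / real n) * (\<Sum>t=1..n. E (\<lambda>\<omega>. ?F (z \<omega> t)))"
    by (simp add: sum_distrib_left)
  also have "(\<Sum>t=1..n. E (\<lambda>\<omega>. ?F (z \<omega> t))) = (\<Sum>t<n. E (\<lambda>\<omega>. ?F (z \<omega> (Suc t))))"
    by (rule sum.reindex_bij_witness[of _ Suc "\<lambda>t. t - 1"]) auto
  also have "\<dots> \<le> (\<Sum>t<n. A + w * (D t - D (Suc t)))"
    unfolding z_def A_def D_def w_def using step_expectation[OF s _ y]
    by (intro sum_mono) (auto simp: algebra_simps)
  also have "\<dots> = n * A + w * (D 0 - D n)"
    by (simp add: sum.distrib sum_distrib_left[symmetric] sum_lessThan_telescope')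
  finally have "E (\<lambda>\<omega>. ?F (anchor \<omega> (Suc s))) \<le> (1 / real n) * (n * A + w * (D 0 - D n))"
    by (simp add: mult_left_mono divide_right_mono)
  also have "\<dots> = A + w / n * (D 0 - D n)" using n_pos by (simp add: distrib_left)
  finally show ?thesis by (simp add: A_def D_def algebra_simps)
qed

end

section \<open>The parameters\<close>

lemma loglog_ge_1: "loglog r \<ge> 1"
  by (simp add: loglog_def)

text \<open>With \<open>l = loglog r\<close>, \<open>ln r \<le> exp l\<close> and
  \<open>ln 2 \<ge> 1/2\<close> give \<open>log 2 (4 r) \<le> 4 exp l\<close>. A second logarithm
  gives at most \<open>2 + 2 l\<close>, and \<open>3 + 2 l \<le> 5 l\<close> since
  \<open>l \<ge> 1\<close>.\<close>

lemma log_log_le_loglog: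
  assumes "r \<ge> 1"
  shows "1 + log 2 (log 2 (4 * r)) \<le> 5 * loglog r"
proof -
  define l where "l = loglog r"
  have l: "l \<ge> 1" by (simp add: l_def loglog_ge_1)
  have ln2: "ln (2::real) \<ge> 1/2" using ln_2_less_1 ln2_ge_two_thirds by linarith
  have "ln r \<le> exp l"
  proof (cases "ln r > 0")
    case True
    then have "ln (ln r) \<le> l" using assms by (auto simp: l_def loglog_def)
    then show ?thesis using True by (metis exp_le_cancel_iff exp_ln)
  qed (use exp_gt_zero[of l] in linarith)
  have "log 2 (4 * r) = 2 + ln r / ln 2"
    using assms log_pow_cancel[of 2 2] by (simp add: log_def ln_mult add_divide_distrib)
  also have "ln r / ln 2 \<le> ln r / (1/2)"
    using assms ln2 by (intro divide_left_mono) auto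
  also have "\<dots> \<le> 2 * exp l" using \<open>ln r \<le> exp l\<close> by simp
  also have "2 + 2 * exp l \<le> 4 * exp l" using l by simp
  finally have "log 2 (4 * r) \<le> 4 * exp l" by simp
  moreover have "log 2 (4 * r) > 0" using assms by simp
  ultimately have "log 2 (log 2 (4 * r)) \<le> log 2 (4 * exp l)" by simp
  also have "\<dots> = 2 + l / ln 2"
    using log_pow_cancel[of 2 2] by (simp add: log_def ln_mult add_divide_distrib)
  also have "l / ln 2 \<le> l / (1/2)"
    using l ln2 by (intro divide_left_mono) auto
  finally show ?thesis using l unfolding l_def by simp
qed

text \<open>\<open>s0\<close> extended to real arguments: for large \<open>\<epsilon>\<close> the
  run stops within the early phase, after a number of epochs governed by
  \<open>V / \<epsilon>\<close> in place of \<open>n\<close>.\<close>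

definition loglog_ceil :: "real \<Rightarrow> nat"
  where "loglog_ceil r = nat \<lceil>log 2 (log 2 (4 * r))\<rceil>"

lemma log2_4_mult_ge_2: "r \<ge> 1 \<Longrightarrow> log 2 (4 * r) \<ge> 2"
  by (simp add: le_log_iff)

lemma loglog_ceil_ge_1:
  assumes "r \<ge> 1" shows "loglog_ceil r \<ge> 1"
proof -
  have "log 2 (log 2 (4 * r)) \<ge> 1"
    using log2_4_mult_ge_2[OF assms] by (subst le_log_iff) auto
  then show ?thesis by (simp add: loglog_ceil_def nat_le_iff le_nat_iff; linarith)
qed

lemma loglog_ceil_bounds:
  assumes "r \<ge> 1"
  shows "log 2 (log 2 (4 * r)) \<le> loglog_ceil r"
    "loglog_ceil r < 1 + log 2 (log 2 (4 * r))"
  using loglog_ceil_ge_1[OF assms] unfolding loglog_ceil_def by linarith+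

lemma loglog_ceil_mono:
  assumes "1 \<le> r" "r \<le> r'" shows "loglog_ceil r \<le> loglog_ceil r'"
proof -
  have "log 2 (4 * r) \<le> log 2 (4 * r')" using assms by simp
  moreover have "log 2 (4 * r) > 0" using log2_4_mult_ge_2[OF assms(1)] by linarith
  ultimately have "log 2 (log 2 (4 * r)) \<le> log 2 (log 2 (4 * r'))" by simp
  then show ?thesis unfolding loglog_ceil_def by (intro nat_mono ceiling_mono)
qed

text \<open>Two base-2 logarithms make the condition linear in \<open>m\<close>. Hence
  \<open>loglog_ceil r\<close> is the first number of repeated square roots that brings
  \<open>4 r\<close> down to at most 2.\<close>

lemma powr_half_power_le_2_iff:
  assumes "r \<ge> 1"
  shows "(4 * r) powr ((1/2) ^ m) \<le> 2 \<longleftrightarrow> log 2 (log 2 (4 * r)) \<le> m"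
proof -
  have pos: "log 2 (4 * r) > 0" using log2_4_mult_ge_2[OF assms] by linarith
  have "(4 * r) powr ((1/2) ^ m) \<le> 2 \<longleftrightarrow> log 2 ((4 * r) powr ((1/2) ^ m)) \<le> 1"
    using assms by (subst log_le_iff) auto
  also have "\<dots> \<longleftrightarrow> log 2 (4 * r) \<le> 2 ^ m"
    using assms by (simp add: log_powr power_one_over field_simps)
  also have "\<dots> \<longleftrightarrow> log 2 (log 2 (4 * r)) \<le> m"
    using pos by (subst log_le_iff) (auto simp: powr_realpow)
  finally show ?thesis .
qed

lemma powr_half_Suc_squared:
  "x > 0 \<Longrightarrow> (x powr ((1/2) ^ Suc m))\<^sup>2 = x powr ((1/2) ^ m)" for x :: real
  by (simp add: powr_power field_simps)

section \<open>The constant \<open>c\<close> and the weight function \<open>\<rho>\<close>\<close>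

lemma vrag_c_bounds: "2 < vrag_c" "vrag_c < 11/5"
proof -
  have "sqrt 33 > 5" by (rule real_less_rsqrt) simp
  moreover have "sqrt 33 < 29/5" by (rule real_less_lsqrt) (simp_all add: power2_eq_square)
  ultimately show "2 < vrag_c" "vrag_c < 11/5" by (simp_all add: vrag_c_def)
qed

lemma vrag_c_root: "2 * vrag_c\<^sup>2 = 3 * vrag_c + 3"
  by (simp add: vrag_c_def power2_eq_square field_simps)

text \<open>
  In terms of \<open>\<rho> a\<close> the weight of the squared distances in the one-epoch inequality is
  \<open>\<beta> / (2 n \<rho> a)\<close>.
\<close>

definition \<rho> :: "real \<Rightarrow> real"
  where "\<rho> a = (1 - a) / ((2 - a) * a\<^sup>2)"

text \<open>The constant \<open>c\<close> is the one for which the case \<open>k = 0\<close> holds with equality.\<close>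

lemma rho_step:
  assumes k: "k \<ge> 0"
  defines "b \<equiv> vrag_c / (k + 2 * vrag_c)" and "b' \<equiv> vrag_c / (k + 1 + 2 * vrag_c)"
  shows "(1 - b') * \<rho> b' \<le> \<rho> b"
proof -
  define c where "c = vrag_c"
  define z where "z = k + 2 * c"
  define y where "y = z + 1"
  have c: "2 < c" "c < 11/5" "2 * c\<^sup>2 = 3 * c + 3"
    using vrag_c_bounds vrag_c_root by (simp_all add: c_def)
  have b: "b = c / z" "b' = c / y"
    by (simp_all add: b_def b'_def c_def z_def y_def add_ac)
  have zy: "z > 0" "y > 0" "2 * z - c > 0" "2 * y - c > 0" using c k by (auto simp: z_def y_def)
  \<comment> \<open>The inequality after clearing denominators, as a polynomial in \<open>k\<close>.
    The quadratic relation for \<open>c\<close> removes the constant term, and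
    \<open>2 < c < 5\<close> makes the other coefficients nonnegative.\<close>
  have "4 * ((z - c) * z\<^sup>2 * (2 * y - c) - (y - c)\<^sup>2 * y * (2 * z - c))
      = (8 * c - 16) * k ^ 3 + (30 - 6 * c) * k\<^sup>2 + (19 * c + 1) * k"
    unfolding y_def z_def using c(3) by algebra
  moreover have "(8 * c - 16) * k ^ 3 + (30 - 6 * c) * k\<^sup>2 + (19 * c + 1) * k \<ge> 0"
    using c k by (intro add_nonneg_nonneg mult_nonneg_nonneg) auto
  ultimately have "0 \<le> 4 * ((z - c) * z\<^sup>2 * (2 * y - c) - (y - c)\<^sup>2 * y * (2 * z - c))"
    by (simp only:)
  then have "(y - c)\<^sup>2 * y * (2 * z - c) \<le> (z - c) * z\<^sup>2 * (2 * y - c)"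
    by (simp only: zero_le_mult_iff) simp
  then have "(y - c)\<^sup>2 * y / (2 * y - c) \<le> (z - c) * z\<^sup>2 / (2 * z - c)"
    using zy by (simp add: field_simps)
  then have "((y - c)\<^sup>2 * y / (2 * y - c)) / c\<^sup>2 \<le> ((z - c) * z\<^sup>2 / (2 * z - c)) / c\<^sup>2"
    by (rule divide_right_mono) simp
  moreover have "(1 - b') * \<rho> b' = ((y - c)\<^sup>2 * y / (2 * y - c)) / c\<^sup>2"
    using zy c(1) unfolding b \<rho>_def by (simp add: divide_simps power2_eq_square)
  moreover have "\<rho> b = ((z - c) * z\<^sup>2 / (2 * z - c)) / c\<^sup>2"
    using zy c(1) unfolding b \<rho>_def by (simp add: divide_simps power2_eq_square)
  ultimately show ?thesis by simp
qed

lemma rho_antimono: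
  assumes "0 < a" "a \<le> a'" "a' < 1"
  shows "\<rho> a' \<le> \<rho> a"
proof -
  have "(1 - a') / (2 - a') \<le> (1 - a) / (2 - a)"
    using assms by (simp add: field_simps)
  moreover have "1 / a'\<^sup>2 \<le> 1 / a\<^sup>2"
    using assms by (intro divide_left_mono power_mono) auto
  ultimately have "(1 - a') / (2 - a') * (1 / a'\<^sup>2) \<le> (1 - a) / (2 - a) * (1 / a\<^sup>2)"
    using assms by (intro mult_mono) auto
  then show ?thesis by (simp add: \<rho>_def)
qed

lemma rho_lower:
  assumes "0 < a" "a \<le> 1/2"
  shows "1 / (4 * a\<^sup>2) \<le> \<rho> a"
proof -
  have "1 / 4 \<le> (1 - a) / (2 - a)" using assms by (simp add: field_simps)
  then have "1 / 4 / a\<^sup>2 \<le> (1 - a) / (2 - a) / a\<^sup>2" by (rule divide_right_mono) simp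
  then show ?thesis by (simp add: \<rho>_def)
qed

lemma rho_upper:
  assumes q: "0 < q" "q\<^sup>2 \<le> 1/2"
  shows "\<rho> (1 - q) \<le> 5"
proof -
  have "q\<^sup>2 \<le> (71/100)\<^sup>2" using q by (simp add: power2_eq_square)
  \<comment> \<open>\<open>71/100\<close> lies just above the square root of 1/2; the constant 5
    works because \<open>5 * (1/2) * (29/100)\<close> still exceeds it.\<close>
  then have q': "q \<le> 71/100" by (rule power2_le_imp_le) simp
  have "(1/2) * (29/100) \<le> (1 - q\<^sup>2) * (1 - q)" using q q' by (intro mult_mono) auto
  then have "q \<le> 5 * ((1 - q\<^sup>2) * (1 - q))" using q' by linarith
  moreover have "(1 - q\<^sup>2) * (1 - q) = (1 + q) * (1 - q)\<^sup>2" by algebra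
  ultimately show ?thesis using q q' by (simp add: \<rho>_def pos_divide_le_eq)
qed

section \<open>The recurrence\<close>

lemma vrag_a_range:
  assumes "n \<ge> 1"
  shows "0 < vrag_a n s \<and> vrag_a n s < 1"
proof (cases "s \<le> s0 n")
  case True
  have "(4 * real n) powr (- ((1/2) ^ s)) < 1" using assms by (intro powr_less_one) auto
  then show ?thesis using True assms by (simp add: vrag_a_def)
next
  case False
  then show ?thesis using vrag_c_bounds by (simp add: vrag_a_def field_simps)
qed

text \<open>The deterministic content of the epoch inequalities. Nonnegativity of
  \<open>\<Delta>\<close> is recorded for \<open>s < S\<close>, the range in which the anchors have
  been shown to lie in \<open>X\<close>.\<close>

locale vrag_recurrence =
  fixes n :: nat and \<beta> :: real and S :: nat and \<Delta> D :: "nat \<Rightarrow> real" and V :: real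
  assumes n: "n \<ge> 1" and beta: "\<beta> > 0"
    and D_nonneg: "\<And>s. D s \<ge> 0" and \<Delta>_nonneg: "\<And>s. s < S \<Longrightarrow> \<Delta> s \<ge> 0"
    and V: "V = 1/2 * \<Delta> 0 + \<beta> * D 0"
    and rec: "\<And>s. s < S \<Longrightarrow>
      \<Delta> (Suc s) + \<beta> / (2 * n * \<rho> (vrag_a n (Suc s))) * D (Suc s)
      \<le> (1 - vrag_a n (Suc s)) * \<Delta> s + \<beta> / (2 * n * \<rho> (vrag_a n (Suc s))) * D s"
begin

section \<open>Early epochs: repeated square roots of \<open>4 n\<close>\<close>

definition p :: "nat \<Rightarrow> real"
  where "p s = (4 * real n) powr ((1/2) ^ s)"

lemma p_0: "p 0 = 4 * real n"
  using n by (simp add: p_def)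

lemma p_Suc: "(p (Suc s))\<^sup>2 = p s"
  unfolding p_def using n by (intro powr_half_Suc_squared) simp

lemma p_gt_1: "p s > 1"
  unfolding p_def using n by (intro gr_one_powr) auto

lemma s0_eq: "s0 n = loglog_ceil (real n)"
  by (simp add: s0_def loglog_ceil_def)

lemma vrag_a_early: "s \<le> s0 n \<Longrightarrow> vrag_a n s = 1 - 1 / p s"
  by (simp add: vrag_a_def p_def powr_minus_divide)

lemma vrag_a_late: "vrag_a n (s0 n + Suc k) = vrag_c / (real k + 1 + 2 * vrag_c)"
  by (simp add: vrag_a_def add_ac)

text \<open>With \<open>q = 1 / P\<close> the right side is the left side times
  \<open>(1 + q^2) (1 + q)\<close>, which is at least 1.\<close>

lemma weight_decreases:
  assumes "P > (1::real)"
  shows "1 / \<rho> (1 - 1 / P) \<le> (1 / P) * (1 / \<rho> (1 - 1 / P\<^sup>2))"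
proof -
  define q where "q = 1 / P"
  have q: "0 < q" "q < 1" and P: "1 / P\<^sup>2 = q\<^sup>2"
    using assms by (auto simp: q_def power_one_over)
  have q2: "q\<^sup>2 < 1" using q by (simp add: power_less_one_iff)
  have "1 \<le> (1 + q\<^sup>2) * (1 + q)" using q mult_mono[of 1 "1 + q\<^sup>2" 1 "1 + q"] by simp
  then have "((1 + q) * (1 - q)\<^sup>2 / q) * 1 \<le> ((1 + q) * (1 - q)\<^sup>2 / q) * ((1 + q\<^sup>2) * (1 + q))"
    using q by (intro mult_left_mono) auto
  also have "\<dots> = q * ((1 + q\<^sup>2) * (1 - q\<^sup>2)\<^sup>2 / q\<^sup>2)"
  proof -
    have "1 - q\<^sup>2 = (1 - q) * (1 + q)" by algebra
    then show ?thesis using q by (simp add: power_mult_distrib divide_simps power2_eq_square)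
  qed
  finally show ?thesis
    unfolding P q_def[symmetric] \<rho>_def by simp
qed

text \<open>The bound reproduces itself: an epoch contracts by \<open>1 / p (Suc s)\<close>, which
  turns \<open>p s = (p (Suc s))^2\<close> into \<open>p (Suc s)\<close>. At \<open>s = 1\<close>
  one has \<open>q^2 = 1 / (4 n)\<close> for \<open>q = 1 / p 1\<close>, so the target
  \<open>V * p 1 / (2 n)\<close> is \<open>2 q V\<close>.\<close>

lemma early_bound:
  assumes "1 \<le> s" "s \<le> s0 n" "s \<le> S"
  shows "\<Delta> s + \<beta> / (2 * n * \<rho> (vrag_a n s)) * D s \<le> V * p s / (2 * n)"
  using assms
proof (induction s rule: nat_induct_at_least)
  case base
  define q where "q = 1 / p (Suc 0)"
  have q: "0 < q" "q < 1" using p_gt_1[of "Suc 0"] by (auto simp: q_def)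
  have q2: "q\<^sup>2 = 1 / (4 * n)" using p_Suc[of 0] by (simp add: q_def p_0 power_one_over)
  have pq: "p (Suc 0) / (2 * n) = 2 * q"
  proof -
    have "p (Suc 0) / (2 * n) = 2 * (1 / (4 * n)) * p (Suc 0)" by simp
    also have "\<dots> = 2 * q" unfolding q2[symmetric] using p_gt_1[of "Suc 0"] by (simp add: q_def power2_eq_square)
    finally show ?thesis .
  qed
  have a: "vrag_a n (Suc 0) = 1 - q" using base by (simp add: vrag_a_early q_def)
  have "(1 - q\<^sup>2) * (1 - q) \<le> 1 * 1" using q by (intro mult_mono) (auto simp: power_le_one)
  moreover have "(1 - q\<^sup>2) * (1 - q) = (1 + q) * (1 - q)\<^sup>2" by algebra
  ultimately have "(1 + q) * (1 - q)\<^sup>2 / q \<le> 1 / q" using q by (intro divide_right_mono) auto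
  then have "(\<beta> / (2 * n)) * ((1 + q) * (1 - q)\<^sup>2 / q) \<le> (\<beta> / (2 * n)) * (1 / q)"
    using beta by (intro mult_left_mono) auto
  also have "\<dots> = 2 * q * \<beta>"
  proof -
    have "\<beta> / (2 * n) = 2 * \<beta> * q\<^sup>2" using q2 by simp
    then show ?thesis using q by (simp add: power2_eq_square)
  qed
  finally have w: "\<beta> / (2 * n * \<rho> (1 - q)) \<le> 2 * q * \<beta>" by (simp add: \<rho>_def)
  have "\<Delta> (Suc 0) + \<beta> / (2 * n * \<rho> (1 - q)) * D (Suc 0) \<le> q * \<Delta> 0 + \<beta> / (2 * n * \<rho> (1 - q)) * D 0"
    using rec[of 0] base by (simp add: a)
  also have "\<dots> \<le> q * \<Delta> 0 + 2 * q * \<beta> * D 0"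
    using w D_nonneg by (intro add_left_mono mult_right_mono)
  \<comment> \<open>The weights \<open>1/2\<close> and \<open>\<beta>\<close> in \<open>V\<close>
    fit the factors \<open>q\<close> and \<open>2 q \<beta>\<close> obtained here.\<close>
  also have "\<dots> = V * (2 * q)" by (simp add: V algebra_simps)
  finally show ?case using pq by (simp add: a mult.assoc times_divide_eq_right[symmetric] del: times_divide_eq_right)
next
  case (Suc s)
  let ?P = "p (Suc s)"
  have P: "?P > 1" by (rule p_gt_1)
  have a: "vrag_a n (Suc s) = 1 - 1 / ?P" "vrag_a n s = 1 - 1 / ?P\<^sup>2"
    using Suc.prems by (simp_all add: vrag_a_early p_Suc)
  have "(\<beta> / (2 * n)) * (1 / \<rho> (1 - 1 / ?P)) \<le> (\<beta> / (2 * n)) * ((1 / ?P) * (1 / \<rho> (1 - 1 / ?P\<^sup>2)))"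
    using weight_decreases[OF P] beta by (intro mult_left_mono) auto
  then have w: "\<beta> / (2 * n * \<rho> (vrag_a n (Suc s))) \<le> (1 / ?P) * (\<beta> / (2 * n * \<rho> (vrag_a n s)))"
    by (simp add: a mult_ac)
  have "\<Delta> (Suc s) + \<beta> / (2 * n * \<rho> (vrag_a n (Suc s))) * D (Suc s)
      \<le> (1 / ?P) * \<Delta> s + \<beta> / (2 * n * \<rho> (vrag_a n (Suc s))) * D s"
    using rec[of s] Suc.prems by (simp add: a)
  also have "\<dots> \<le> (1 / ?P) * \<Delta> s + (1 / ?P) * (\<beta> / (2 * n * \<rho> (vrag_a n s))) * D s"
    using w D_nonneg by (intro add_left_mono mult_right_mono)
  also have "\<dots> = (1 / ?P) * (\<Delta> s + \<beta> / (2 * n * \<rho> (vrag_a n s)) * D s)"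
    by (simp only: distrib_left mult.assoc)
  also have "\<dots> \<le> (1 / ?P) * (V * p s / (2 * n))"
    using Suc P by (intro mult_left_mono) auto
  also have "\<dots> = V * ?P / (2 * n)"
    using P unfolding p_Suc[of s, symmetric] by (simp add: power2_eq_square)
  finally show ?case .
qed

section \<open>Handover from early to late weights\<close>

lemma s0_ge_1: "s0 n \<ge> 1"
  using loglog_ceil_ge_1 n by (simp add: s0_eq)

text \<open>\<open>s0 n\<close> is the first index with \<open>p\<close> at most 2, so its
  predecessor, which is the square, exceeds 2. The first bound keeps the last early weight at most
  1/2, the second keeps \<open>\<rho>\<close> bounded there.\<close>

lemma p_s0: "p (s0 n) \<le> 2" "2 \<le> (p (s0 n))\<^sup>2"
proof -
  have r: "real n \<ge> 1" using n by simp
  note iff = powr_half_power_le_2_iff[OF r, folded p_def]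
  show "p (s0 n) \<le> 2" using iff[of "s0 n"] loglog_ceil_bounds[OF r] by (simp add: s0_eq)
  obtain m where m: "s0 n = Suc m" using s0_ge_1 by (cases "s0 n") auto
  then have "p m > 2" using iff[of m] loglog_ceil_bounds[OF r] by (auto simp: s0_eq)
  then show "2 \<le> (p (s0 n))\<^sup>2" by (simp add: m p_Suc)
qed

lemma vrag_a_s0: "0 < vrag_a n (s0 n)" "vrag_a n (s0 n) \<le> 1/2" "\<rho> (vrag_a n (s0 n)) \<le> 5"
proof -
  let ?P = "p (s0 n)"
  have P: "?P > 1" by (rule p_gt_1)
  then show "0 < vrag_a n (s0 n)" "vrag_a n (s0 n) \<le> 1/2"
    using p_s0(1) by (auto simp: vrag_a_early field_simps)
  show "\<rho> (vrag_a n (s0 n)) \<le> 5"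
    unfolding vrag_a_early[OF order.refl]
    using P p_s0(2) by (intro rho_upper) (auto simp: power_one_over field_simps)
qed

section \<open>Late epochs: telescoping\<close>

lemma rho_vrag_a_pos:
  assumes "0 < vrag_a n s" "vrag_a n s < 1" shows "\<rho> (vrag_a n s) > 0"
  using assms by (simp add: \<rho>_def)

text \<open>Multiplying by \<open>\<rho>\<close> gives the squared distances the same weight
  \<open>\<beta> / (2 n)\<close> in all epochs, so that they telescope.\<close>

lemma scaled_rec:
  assumes "s < S" "0 < vrag_a n (Suc s)" "vrag_a n (Suc s) < 1"
  shows "\<rho> (vrag_a n (Suc s)) * \<Delta> (Suc s) + \<beta> / (2 * n) * D (Suc s)
    \<le> (1 - vrag_a n (Suc s)) * \<rho> (vrag_a n (Suc s)) * \<Delta> s + \<beta> / (2 * n) * D s"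
proof -
  let ?r = "\<rho> (vrag_a n (Suc s))"
  have r: "?r > 0" by (rule rho_vrag_a_pos[OF assms(2,3)])
  have "?r * (\<beta> / (2 * n * ?r)) = \<beta> / (2 * n)" using r by simp
  then have w: "?r * (\<beta> / (2 * n * ?r) * x) = \<beta> / (2 * n) * x" for x by (simp only: mult.assoc[symmetric])
  have "?r * (\<Delta> (Suc s) + \<beta> / (2 * n * ?r) * D (Suc s))
      \<le> ?r * ((1 - vrag_a n (Suc s)) * \<Delta> s + \<beta> / (2 * n * ?r) * D s)"
    using rec[OF assms(1)] r by (intro mult_left_mono) auto
  then show ?thesis unfolding distrib_left w by (simp add: mult_ac)
qed

lemma late_vrag_a: "0 < vrag_a n (s0 n + Suc k)" "vrag_a n (s0 n + Suc k) \<le> 1/2"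
    "vrag_a n (s0 n + Suc k) \<le> 11/5 / real (Suc k)"
proof -
  note c = vrag_c_bounds
  show "0 < vrag_a n (s0 n + Suc k)" "vrag_a n (s0 n + Suc k) \<le> 1/2"
    unfolding vrag_a_late using c by (auto simp: field_simps intro!: divide_pos_pos)
  show "vrag_a n (s0 n + Suc k) \<le> 11/5 / real (Suc k)"
    unfolding vrag_a_late using c by (intro frac_le) auto
qed

text \<open>By \<open>rho_step\<close> the left side does not increase from one late epoch to the
  next; its initial value is at most \<open>\<rho> \<le> 5\<close> times the early bound
  \<open>V / n\<close>.\<close>

lemma late_invariant:
  assumes "s0 n + Suc k \<le> S"
  shows "\<rho> (vrag_a n (s0 n + Suc k)) * \<Delta> (s0 n + Suc k) + \<beta> / (2 * n) * D (s0 n + Suc k)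
    \<le> 5 * V / n"
  using assms
proof (induction k)
  case 0
  let ?a = "vrag_a n (s0 n)" and ?b = "vrag_a n (Suc (s0 n))"
  have b: "0 < ?b" "?b < 1" using late_vrag_a[of 0] by auto
  have r: "\<rho> ?a > 0" using vrag_a_s0 by (intro rho_vrag_a_pos) auto
  \<comment> \<open>At \<open>k = 0\<close> the late formula gives \<open>c / (2 c) = 1/2\<close>.
    The actual previous weight is at most 1/2, and \<open>\<rho>\<close> is decreasing, so the
    handover fits the invariant.\<close>
  have "(1 - ?b) * \<rho> ?b \<le> \<rho> (1/2)"
    using rho_step[of 0] vrag_a_late[of 0] vrag_c_bounds by simp
  also have "\<dots> \<le> \<rho> ?a" using vrag_a_s0 by (intro rho_antimono) auto
  finally have step: "(1 - ?b) * \<rho> ?b \<le> \<rho> ?a" .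
  have "\<rho> ?b * \<Delta> (Suc (s0 n)) + \<beta> / (2 * n) * D (Suc (s0 n))
      \<le> (1 - ?b) * \<rho> ?b * \<Delta> (s0 n) + \<beta> / (2 * n) * D (s0 n)"
    using 0 b by (intro scaled_rec) auto
  also have "\<dots> \<le> \<rho> ?a * \<Delta> (s0 n) + \<beta> / (2 * n) * D (s0 n)"
    using step \<Delta>_nonneg[of "s0 n"] 0 by (intro add_right_mono mult_right_mono) auto
  also have "\<dots> = \<rho> ?a * (\<Delta> (s0 n) + \<beta> / (2 * n * \<rho> ?a) * D (s0 n))"
    using r by (simp add: distrib_left)
  also have "\<dots> \<le> \<rho> ?a * (V / n)"
  proof (intro mult_left_mono)
    have "V \<ge> 0" unfolding V using \<Delta>_nonneg[of 0] D_nonneg beta 0 by simp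
    then have "V * p (s0 n) / (2 * n) \<le> V * 2 / (2 * n)"
      using p_s0(1) by (intro divide_right_mono mult_left_mono) auto
    then show "\<Delta> (s0 n) + \<beta> / (2 * n * \<rho> ?a) * D (s0 n) \<le> V / n"
      using early_bound[of "s0 n"] s0_ge_1 0 by simp
  qed (use r in simp)
  also have "\<dots> \<le> 5 * (V / n)"
  proof (rule mult_right_mono[OF vrag_a_s0(3)])
    show "0 \<le> V / n" unfolding V using \<Delta>_nonneg[of 0] D_nonneg beta 0 by simp
  qed
  finally show ?case by simp
next
  case (Suc k)
  let ?b = "vrag_a n (s0 n + Suc k)" and ?b' = "vrag_a n (Suc (s0 n + Suc k))"
  have b': "0 < ?b'" "?b' < 1" using late_vrag_a[of "Suc k"] by auto
  have "(1 - ?b') * \<rho> ?b' \<le> \<rho> ?b"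
    using rho_step[of "real k + 1"] vrag_a_late[of k] vrag_a_late[of "Suc k"] by (simp add: add_ac)
  then have "(1 - ?b') * \<rho> ?b' * \<Delta> (s0 n + Suc k) + \<beta> / (2 * n) * D (s0 n + Suc k)
      \<le> \<rho> ?b * \<Delta> (s0 n + Suc k) + \<beta> / (2 * n) * D (s0 n + Suc k)"
    using \<Delta>_nonneg[of "s0 n + Suc k"] Suc.prems by (intro add_right_mono mult_right_mono) auto
  with scaled_rec[of "s0 n + Suc k"] Suc b' show ?case by simp
qed

text \<open>The weight is at most \<open>(11/5) / k\<close>, so \<open>\<rho>\<close> is at least
  \<open>k^2 / 20\<close>, and \<open>100 = 5 * 20\<close>. Nonnegativity of the gap is a hypothesis
  because \<open>s0 n + k\<close> may equal \<open>S\<close>, where the locale does not provide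
  it.\<close>

lemma late_bound:
  assumes "s0 n + k \<le> S" "k \<ge> 1" "\<Delta> (s0 n + k) \<ge> 0"
  shows "\<Delta> (s0 n + k) \<le> 100 * V / (n * (real k)\<^sup>2)"
proof -
  obtain m where m: "k = Suc m" using assms(2) by (cases k) auto
  let ?b = "vrag_a n (s0 n + k)"
  have b: "0 < ?b" "?b \<le> 1/2" "?b \<le> 11/5 / k" using late_vrag_a[of m] by (simp_all add: m)
  have k: "real k > 0" using m by simp
  have "?b\<^sup>2 \<le> (11/5 / k)\<^sup>2" using b by (intro power_mono) auto
  also have "\<dots> \<le> 5 / k\<^sup>2" using k by (simp add: power2_eq_square divide_simps)
  finally have "4 * ?b\<^sup>2 \<le> 20 / (real k)\<^sup>2" by simp
  then have "1 / (20 / (real k)\<^sup>2) \<le> 1 / (4 * ?b\<^sup>2)"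
    using b k by (intro divide_left_mono) auto
  also have "\<dots> \<le> \<rho> ?b" using b by (intro rho_lower)
  finally have "(real k)\<^sup>2 / 20 * \<Delta> (s0 n + k) \<le> \<rho> ?b * \<Delta> (s0 n + k)"
    using assms(3) by (intro mult_right_mono) auto
  also have "\<dots> \<le> 5 * V / n"
  proof -
    have "0 \<le> \<beta> / (2 * n) * D (s0 n + k)"
      using D_nonneg beta by (intro mult_nonneg_nonneg) auto
    then show ?thesis using late_invariant[of m, folded m] assms(1) by linarith
  qed
  finally have "\<Delta> (s0 n + k) \<le> (5 * V / n) / ((real k)\<^sup>2 / 20)"
    using k by (subst pos_le_divide_eq) (auto simp: mult.commute)
  then show ?thesis by simp
qed

end

section \<open>Complexity\<close>

lemma vrag_grads_const: "vrag_grads n (\<lambda>_. n) S = S * (3 * n)"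
  by (simp add: vrag_grads_def)

context vrag_problem
begin

text \<open>The first argument of \<open>\<Delta>\<close> fixes the law and the second the epoch, so
  the value at \<open>s = S\<close> is the expectation in the theorem. \<open>D\<close> is only
  obtained, since the final bounds see it through \<open>V\<close> alone.\<close>

lemma vrag_recurrence_instance:
  assumes u0: "u0 \<in> X" and xstar: "is_arg_min (objective n f h) (\<lambda>x. x \<in> X) xstar"
    and V: "V = 1/2 * (objective n f h u0 - objective n f h xstar) + \<beta> * (norm (u0 - xstar))\<^sup>2"
  defines "\<Delta> \<equiv> \<lambda>S s. measure_pmf.expectation (vrag_draws n (\<lambda>_. n) S)
    (\<lambda>\<omega>. objective n f h (vrag_output d n \<beta> X f h (vrag_a n) (\<lambda>_. n) u0 s \<omega>) - objective n f h xstar)"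
  obtains D where "vrag_recurrence n \<beta> S (\<Delta> S) D V"
proof -
  interpret vrag_run d n \<beta> X f h "vrag_a n" u0 S
    by standard (use u0 vrag_a_range[OF n_pos] in auto)
  define D where "D s = E (\<lambda>\<omega>. (norm (xstar - iterate \<omega> s 0))\<^sup>2)" for s
  have \<Delta>: "\<Delta> S s = E (\<lambda>\<omega>. objective n f h (anchor \<omega> s) - objective n f h xstar)" for s
    by (simp add: \<Delta>_def vrag_output_def anchor_def)
  have xs: "xstar \<in> X" "\<And>x. x \<in> X \<Longrightarrow> objective n f h xstar \<le> objective n f h x"
    using xstar by (auto simp: is_arg_min_linorder)
  have "vrag_recurrence n \<beta> S (\<Delta> S) D V"
  proof
    show "D s \<ge> 0" for s by (simp add: D_def)
    show "\<Delta> S s \<ge> 0" if "s < S" for s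
    proof -
      have "E (\<lambda>_. 0) \<le> \<Delta> S s"
        unfolding \<Delta> using iterates_in_X[OF _ that] xs(2) by (intro E_mono) auto
      then show ?thesis by simp
    qed
    show "V = 1/2 * \<Delta> S 0 + \<beta> * D 0"
      by (simp add: V \<Delta> D_def anchor_0 iterate_0_0 norm_minus_commute)
    show "\<Delta> S (Suc s) + \<beta> / (2 * n * \<rho> (vrag_a n (Suc s))) * D (Suc s)
      \<le> (1 - vrag_a n (Suc s)) * \<Delta> S s + \<beta> / (2 * n * \<rho> (vrag_a n (Suc s))) * D s"
      if "s < S" for s
    proof -
      let ?a = "vrag_a n (Suc s)"
      have "\<beta> * (2 - ?a) * ?a\<^sup>2 / (2 * (1 - ?a)) / n = \<beta> / (2 * n * \<rho> ?a)"
        by (simp add: \<rho>_def mult_ac)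
      then show ?thesis
        using epoch_expectation[OF that xs(1)] unfolding \<Delta> D_def iterate_Suc_0 by (simp only:)
    qed
  qed (use n_pos beta_pos in auto)
  then show ?thesis by (rule that)
qed

text \<open>An epoch costs \<open>3 n\<close> evaluations. The constant 30 is 3 times the 10 that
  comes from the square root of 100 in the late bound; the double-logarithmic terms need only 15 and
  18.\<close>

lemma complexity:
  assumes u0: "u0 \<in> X" and xstar: "is_arg_min (objective n f h) (\<lambda>x. x \<in> X) xstar"
    and V: "V = 1/2 * (objective n f h u0 - objective n f h xstar) + \<beta> * (norm (u0 - xstar))\<^sup>2"
    and \<epsilon>: "\<epsilon> > 0"
  shows "\<exists>S\<ge>1. measure_pmf.expectation (vrag_draws n (\<lambda>_. n) S)
        (\<lambda>\<omega>. objective n f h (vrag_output d n \<beta> X f h (vrag_a n) (\<lambda>_. n) u0 S \<omega>)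
          - objective n f h xstar) \<le> \<epsilon> \<and>
      real (vrag_grads n (\<lambda>_. n) S) \<le> 30 * (if \<epsilon> \<ge> V / real n
        then real n * loglog (V / \<epsilon>)
        else real n * loglog (real n) + sqrt (real n * V / \<epsilon>))"
proof (cases "\<epsilon> \<ge> V / real n")
  case True
  \<comment> \<open>The maximum with 1 covers \<open>V \<le> \<epsilon>\<close> and guarantees at
    least one epoch.\<close>
  define r where "r = max 1 (V / \<epsilon>)"
  define S where "S = loglog_ceil r"
  have n: "real n \<ge> 1" using n_pos by simp
  have r: "r \<ge> 1" "r \<le> n" "V \<le> r * \<epsilon>"
  proof -
    show "r \<ge> 1" by (simp add: r_def)
    show "r \<le> n" using True n \<epsilon> by (simp add: r_def field_simps)
    show "V \<le> r * \<epsilon>" using \<epsilon> by (simp add: r_def pos_divide_le_eq[symmetric])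
  qed
  have S: "1 \<le> S" "S \<le> s0 n"
    using loglog_ceil_ge_1[OF r(1)] loglog_ceil_mono[OF r(1,2)] by (simp_all add: S_def s0_def loglog_ceil_def)
  obtain D where "vrag_recurrence n \<beta> S (\<lambda>s. measure_pmf.expectation (vrag_draws n (\<lambda>_. n) S)
      (\<lambda>\<omega>. objective n f h (vrag_output d n \<beta> X f h (vrag_a n) (\<lambda>_. n) u0 s \<omega>)
        - objective n f h xstar)) D V" (is "vrag_recurrence _ _ _ ?\<Delta> _ _")
    by (rule vrag_recurrence_instance[OF u0 xstar V])
  then interpret R: vrag_recurrence n \<beta> S ?\<Delta> D V .
  have "r * R.p S \<le> 2 * n"
  proof -
    define e :: real where "e = (1/2) ^ S"
    have e: "0 \<le> e" "e \<le> 1" by (simp_all add: e_def power_le_one)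
    have "(4 * r) powr e \<le> 2"
      unfolding e_def using powr_half_power_le_2_iff[OF r(1)] loglog_ceil_bounds(1)[OF r(1)]
      by (simp add: S_def)
    \<comment> \<open>Split \<open>4 r\<close> into its powers \<open>e\<close> and
      \<open>1 - e\<close>: the first is at most 2 by the choice of \<open>S\<close>, the second at
      most \<open>(4 n) powr (1 - e)\<close> by \<open>r \<le> n\<close>.\<close>
    have "2 * r * (4 * n) powr e = (4 * r) powr e * (4 * r) powr (1 - e) * (4 * n) powr e / 2"
      using r by (simp add: powr_add[symmetric])
    also have "\<dots> \<le> 2 * (4 * n) powr (1 - e) * (4 * n) powr e / 2"
      using \<open>(4 * r) powr e \<le> 2\<close> r e
      by (intro divide_right_mono mult_right_mono mult_mono powr_mono2) auto
    also have "\<dots> = 4 * n" using n by (simp add: powr_add[symmetric])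
    finally show ?thesis by (simp add: R.p_def e_def)
  qed
  have rho: "\<rho> (vrag_a n S) \<ge> 0" using vrag_a_range[OF n_pos, of S] by (simp add: \<rho>_def)
  have "0 \<le> \<beta> / (2 * n * \<rho> (vrag_a n S)) * D S"
    using rho beta_pos R.D_nonneg by (intro mult_nonneg_nonneg divide_nonneg_nonneg) auto
  then have "?\<Delta> S \<le> V * R.p S / (2 * n)"
    using R.early_bound[OF S] by linarith
  also have "\<dots> \<le> r * \<epsilon> * R.p S / (2 * n)"
    using r(3) R.p_gt_1[of S] by (intro divide_right_mono mult_right_mono) auto
  also have "\<dots> = \<epsilon> * (r * R.p S / (2 * n))" by simp
  also have "\<dots> \<le> \<epsilon> * 1"
    using \<open>r * R.p S \<le> 2 * n\<close> \<epsilon> n by (intro mult_left_mono) (auto simp: field_simps)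
  finally have acc: "?\<Delta> S \<le> \<epsilon>" by simp
  have "real S \<le> 5 * loglog r"
    using loglog_ceil_bounds(2)[OF r(1)] log_log_le_loglog[OF r(1)] by (simp add: S_def)
  \<comment> \<open>Raising the argument to 1 changes nothing, as \<open>loglog\<close> is 1 up to
    there.\<close>
  also have "loglog r = loglog (V / \<epsilon>)" by (simp add: r_def loglog_def max_def)
  finally have "real n * real S \<le> real n * (5 * loglog (V / \<epsilon>))" by (intro mult_left_mono) auto
  moreover have "0 \<le> real n * loglog (V / \<epsilon>)"
    using loglog_ge_1[of "V / \<epsilon>"] by (intro mult_nonneg_nonneg) auto
  ultimately have "real (vrag_grads n (\<lambda>_. n) S) \<le> 30 * (real n * loglog (V / \<epsilon>))"
    unfolding vrag_grads_const by (simp add: mult_ac)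
  with True S acc show ?thesis by (intro exI[of _ S]) simp
next
  case False
  \<comment> \<open>The least \<open>k\<close> with
    \<open>100 V / (n k^2) \<le> \<epsilon>\<close>.\<close>
  define k where "k = nat \<lceil>sqrt (100 * V / (n * \<epsilon>))\<rceil>"
  define S where "S = s0 n + k"
  have n: "real n \<ge> 1" using n_pos by simp
  have "V / n > 0" using False \<epsilon> by linarith
  then have Vpos: "V > 0" using n by (simp add: zero_less_divide_iff)
  have "sqrt (100 * V / (n * \<epsilon>)) > 0" using Vpos \<epsilon> n by simp
  then have k: "k \<ge> 1" "sqrt (100 * V / (n * \<epsilon>)) \<le> k" "real k \<le> sqrt (100 * V / (n * \<epsilon>)) + 1"
    unfolding k_def by linarith+
  obtain D where "vrag_recurrence n \<beta> S (\<lambda>s. measure_pmf.expectation (vrag_draws n (\<lambda>_. n) S)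
      (\<lambda>\<omega>. objective n f h (vrag_output d n \<beta> X f h (vrag_a n) (\<lambda>_. n) u0 s \<omega>)
        - objective n f h xstar)) D V" (is "vrag_recurrence _ _ _ ?\<Delta> _ _")
    by (rule vrag_recurrence_instance[OF u0 xstar V])
  then interpret R: vrag_recurrence n \<beta> S ?\<Delta> D V .
  have acc: "?\<Delta> S \<le> \<epsilon>"
  \<comment> \<open>\<open>late_bound\<close> asks for a nonnegative gap at the last epoch; a
    negative one is below \<open>\<epsilon>\<close> anyway.\<close>
  proof (cases "?\<Delta> S \<ge> 0")
    case True
    then have "?\<Delta> S \<le> 100 * V / (n * (real k)\<^sup>2)"
      using R.late_bound[of k] k unfolding S_def by simp
    also have "100 * V / (n * \<epsilon>) \<le> (real k)\<^sup>2" using k(2) by (rule sqrt_le_D)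
    then have "100 * V / (n * (real k)\<^sup>2) \<le> \<epsilon>"
      using k(1) n \<epsilon> by (simp add: field_simps)
    finally show ?thesis .
  qed (use \<epsilon> in linarith)
  have sq: "n * sqrt (100 * V / (n * \<epsilon>)) = 10 * sqrt (real n * V / \<epsilon>)"
  proof -
    have "n * sqrt (100 * V / (n * \<epsilon>)) = sqrt ((real n)\<^sup>2 * (100 * V / (n * \<epsilon>)))"
      by (simp only: real_sqrt_mult real_sqrt_abs abs_of_nat)
    also have "(real n)\<^sup>2 * (100 * V / (n * \<epsilon>)) = 10\<^sup>2 * (real n * V / \<epsilon>)"
      using n by (simp add: power2_eq_square)
    also have "sqrt \<dots> = 10 * sqrt (real n * V / \<epsilon>)"
      by (simp only: real_sqrt_mult real_sqrt_abs abs_numeral)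
    finally show ?thesis .
  qed
  have "real (s0 n) + 1 \<le> 1 + 5 * loglog n"
    using loglog_ceil_bounds(2)[OF n] log_log_le_loglog[OF n] by (simp add: s0_def loglog_ceil_def)
  then have "real (s0 n) + 1 \<le> 6 * loglog n" using loglog_ge_1[of n] by linarith
  then have "real S \<le> 6 * loglog n + sqrt (100 * V / (n * \<epsilon>))" using k(3) by (simp add: S_def)
  then have "n * real S \<le> n * (6 * loglog n + sqrt (100 * V / (n * \<epsilon>)))" by (intro mult_left_mono) auto
  then have "n * real S \<le> 6 * (n * loglog n) + 10 * sqrt (real n * V / \<epsilon>)"
    unfolding distrib_left sq by (simp add: mult_ac)
  moreover have "0 \<le> real n * loglog n"
    using loglog_ge_1[of n] by (intro mult_nonneg_nonneg) auto
  ultimately have "real (vrag_grads n (\<lambda>_. n) S)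
      \<le> 30 * (real n * loglog (real n) + sqrt (real n * V / \<epsilon>))"
    unfolding vrag_grads_const by (simp add: mult_ac)
  moreover have "S \<ge> 1" using k by (simp add: S_def)
  ultimately show ?thesis using False acc by (intro exI[of _ S]) simp
qed

end

theorem theoremD1:
  shows "\<exists>C::real. C > 0 \<and>
    (\<forall>(d::nat) (n::nat) (\<beta>::real) (X::fsvec set) (f::nat \<Rightarrow> fsvec \<Rightarrow> real) (h::fsvec \<Rightarrow> real)
       (u0::fsvec) (xstar::fsvec) (V::real) (\<epsilon>::real).
       composite_problem d n \<beta> X f h \<longrightarrow>
       u0 \<in> X \<longrightarrow>
       is_arg_min (objective n f h) (\<lambda>x. x \<in> X) xstar \<longrightarrow>
       V = 1/2 * (objective n f h u0 - objective n f h xstar) + \<beta> * (norm (u0 - xstar))\<^sup>2 \<longrightarrow>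
       \<epsilon> > 0 \<longrightarrow>
       (\<exists>S\<ge>1.
          measure_pmf.expectation (vrag_draws n (\<lambda>s. n) S)
            (\<lambda>\<omega>. objective n f h (vrag_output d n \<beta> X f h (vrag_a n) (\<lambda>s. n) u0 S \<omega>)
                  - objective n f h xstar) \<le> \<epsilon> \<and>
          real (vrag_grads n (\<lambda>s. n) S) \<le>
            C * (if \<epsilon> \<ge> V / real n
                 then real n * loglog (V / \<epsilon>)
                 else real n * loglog (real n) + sqrt (real n * V / \<epsilon>))))"
proof (intro exI[of _ "30::real"] conjI allI impI, goal_cases)
  case (2 d n \<beta> X f h u0 xstar V \<epsilon>)
  interpret vrag_problem d n \<beta> X f h by standard (fact 2)
  from 2 show ?case by (intro complexity)
qed simp

end
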